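(* Let $V$ be a finite-dimensional real vector space and let $\mathcal{C}$ be an open convex cone in $V$. Fix $\beta\ge 1/2$, and let $A,B,C,D\colon\mathcal{C}\to(0,\infty)$. Suppose that $(A+By)^{-\beta}$ and $(C+Dy)^{-\beta}$ are completely monotone on $\mathcal{C}\times(0,\infty)$. Then the same is true of $[AC+(AD+BC)y]^{-\beta}$.
   Context: Here $A,B,C,D$ are functions of $x\in\mathcal{C}$ and $y$ is the variable in $(0,\infty)$; $\mathcal{C}\times(0,\infty)$ is an open convex cone in $V\oplus\mathbb{R}$. For an open convex cone $K$ in a finite-dimensional real vector space, a $C^\infty$ function $f\colon K\to\mathbb{R}$ is completely monotone if for all $k\ge 0$, all $\mathbf{u}_1,\ldots,\mathbf{u}_k\in K$ and all $\mathbf{x}\in K$, one has $(-1)^kD_{\mathbf{u}_1}\cdots D_{\mathbf{u}_k}f(\mathbf{x})\ge 0$, where $D_{\mathbf{u}}$ is the directional derivative. *)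

theory Defs
  imports "HOL-Analysis.Analysis"
begin

(* The library predicates cone, conic and convex_cone require closure under multiplication by
   all c >= 0, so their only open nonempty instance is the whole space. Open convex cones need
   closure under strictly positive scalars only. *)
definition open_convex_cone :: "'a::real_normed_vector set \<Rightarrow> bool" where
  "open_convex_cone K \<longleftrightarrow> open K \<and> convex K \<and> (\<forall>x\<in>K. \<forall>c>0. c *\<^sub>R x \<in> K)"

definition dir_deriv :: "'a::real_normed_vector \<Rightarrow> ('a \<Rightarrow> real) \<Rightarrow> 'a \<Rightarrow> real" where
  "dir_deriv u f x = deriv (\<lambda>t::real. f (x + t *\<^sub>R u)) 0"

(* On an open set K of a finite-dimensional space this is C^n smoothness with, in addition,
   differentiability of the derivatives of order < n spelled out. The values of f outside K are
   irrelevant for open K, also for the iterated directional derivatives. *)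
fun C_k_on :: "nat \<Rightarrow> 'a::real_normed_vector set \<Rightarrow> ('a \<Rightarrow> real) \<Rightarrow> bool" where
  "C_k_on 0 K f \<longleftrightarrow> continuous_on K f"
| "C_k_on (Suc n) K f \<longleftrightarrow>
     (\<forall>x\<in>K. f differentiable (at x)) \<and> (\<forall>u. C_k_on n K (dir_deriv u f))"

definition smooth_on :: "'a::real_normed_vector set \<Rightarrow> ('a \<Rightarrow> real) \<Rightarrow> bool" where
  "smooth_on K f \<longleftrightarrow> (\<forall>n. C_k_on n K f)"

(* The list us = [u_1, ..., u_k] encodes the iterated derivative D_{u_1} ... D_{u_k} f. *)
definition completely_monotone_on :: "'a::real_normed_vector set \<Rightarrow> ('a \<Rightarrow> real) \<Rightarrow> bool" where
  "completely_monotone_on K f \<longleftrightarrow>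
     smooth_on K f \<and>
     (\<forall>us. set us \<subseteq> K \<longrightarrow> (\<forall>x\<in>K. (-1) ^ length us * foldr dir_deriv us f x \<ge> 0))"

lemma dir_deriv_eq_frechet_derivative:
  assumes "f differentiable (at x)"
  shows "dir_deriv u f x = frechet_derivative f (at x) u"
proof -
  let ?F = "frechet_derivative f (at x)"
  have F: "(f has_derivative ?F) (at (x + 0 *\<^sub>R u))"
    using assms by (simp add: frechet_derivative_works)
  have g: "((\<lambda>t::real. x + t *\<^sub>R u) has_derivative (\<lambda>t. t *\<^sub>R u)) (at 0)"
    by (auto intro!: derivative_eq_intros)
  have "((\<lambda>t::real. f (x + t *\<^sub>R u)) has_derivative (\<lambda>t. ?F (t *\<^sub>R u))) (at 0)"
    using has_derivative_compose[OF g F] by simp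
  moreover have "(\<lambda>t. ?F (t *\<^sub>R u)) = (*) (?F u)"
    using has_derivative_linear[OF F] by (auto simp: linear_cmul)
  ultimately show ?thesis
    unfolding dir_deriv_def by (simp add: DERIV_imp_deriv has_field_derivative_def)
qed

lemma open_convex_cone_Times_greaterThan:
  assumes "open_convex_cone C"
  shows "open_convex_cone (C \<times> {0::real<..})"
  using assms unfolding open_convex_cone_def
  by (auto intro!: open_Times convex_Times)

end

theory Submission
  imports Defs "HOL-Probability.Distributions" "HOL-Real_Asymp.Real_Asymp"
begin

text \<open>Write \<open>a = A/B\<close> and \<open>b = C/D\<close>. The function in question is \<open>(B D)\<^sup>-\<^sup>\<beta> E\<^sup>-\<^sup>\<beta>\<close> with
  \<open>E = a b + (a + b) y\<close>, the determinant of the matrix with rows \<open>(a + y, -y)\<close> and \<open>(-y, b + y)\<close>.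
  For \<open>\<beta> \<ge> 1/2\<close> the Wishart integral represents \<open>E\<^sup>-\<^sup>\<beta>\<close> as a mixture of functions
  \<open>exp (-(t a + s b + u y))\<close> with \<open>t, s, u \<ge> 0\<close>. Inverting the Laplace transform in \<open>y\<close> by the
  Post--Widder formula shows that \<open>B\<^sup>-\<^sup>\<beta> exp (-t a)\<close> and \<open>D\<^sup>-\<^sup>\<beta> exp (-s b)\<close> are completely
  monotone; hence so are their products with \<open>exp (-u y)\<close>, and the mixture of these. Both the
  Post--Widder limit and the mixture commute with iterated directional derivatives because such a
  derivative of \<open>g \<phi>(q)\<close> is a fixed linear combination, with coefficients depending only on
  \<open>g\<close> and \<open>q\<close>, of partial derivatives of \<open>\<phi>\<close> at \<open>q\<close>.\<close>

section \<open>Calculus of smooth functions on open sets\<close>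

lemma dir_deriv_eq:
  assumes "(f has_derivative F) (at x)"
  shows "dir_deriv u f x = F u"
  using assms dir_deriv_eq_frechet_derivative[of f x u] frechet_derivative_at[OF assms]
  by (metis differentiable_def)

lemma dir_deriv_cong:
  assumes "open K" "x \<in> K" "\<And>y. y \<in> K \<Longrightarrow> f y = g y"
  shows "dir_deriv u f x = dir_deriv u g x"
proof -
  have "((\<lambda>t::real. x + t *\<^sub>R u) \<longlongrightarrow> x + 0 *\<^sub>R u) (nhds 0)"
    by (intro tendsto_intros filterlim_ident)
  then have "\<forall>\<^sub>F t in nhds 0. x + t *\<^sub>R u \<in> K"
    using assms(1,2) topological_tendstoD by fastforce
  then have "\<forall>\<^sub>F t in nhds 0. f (x + t *\<^sub>R u) = g (x + t *\<^sub>R u)"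
    by eventually_elim (use assms(3) in auto)
  then show ?thesis
    unfolding dir_deriv_def by (intro deriv_cong_ev) auto
qed

lemma foldr_dir_deriv_cong:
  assumes "open K" "x \<in> K" "\<And>y. y \<in> K \<Longrightarrow> f y = g y"
  shows "foldr dir_deriv us f x = foldr dir_deriv us g x"
  using assms(2)
proof (induction us arbitrary: x)
  case Nil
  then show ?case using assms(3) by simp
next
  case (Cons u us)
  have "dir_deriv u (foldr dir_deriv us f) x = dir_deriv u (foldr dir_deriv us g) x"
    by (rule dir_deriv_cong[OF assms(1) Cons.prems Cons.IH])
  then show ?case by simp
qed

lemma differentiable_at_cong:
  assumes "open K" "x \<in> K" "\<And>y. y \<in> K \<Longrightarrow> f y = g y" "f differentiable (at x)"
  shows "g differentiable (at x)"
  using assms has_derivative_transform_within_open[of f _ x UNIV K g]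
  unfolding differentiable_def by auto

lemma C_k_on_SucD: "C_k_on (Suc n) K f \<Longrightarrow> C_k_on n K f"
proof (induction n arbitrary: f)
  case 0
  then show ?case
    by (auto intro!: continuous_at_imp_continuous_on differentiable_imp_continuous_within)
next
  case (Suc n)
  then show ?case using C_k_on.simps(2)[of "Suc n" K f] by auto
qed

lemma C_k_on_cong:
  assumes "open K" "\<And>y. y \<in> K \<Longrightarrow> f y = g y" "C_k_on n K f"
  shows "C_k_on n K g"
  using assms(2,3)
proof (induction n arbitrary: f g)
  case 0
  then show ?case using continuous_on_cong[of K K f g] by simp
next
  case (Suc n)
  have "C_k_on n K (dir_deriv u g)" for u
  proof (rule Suc.IH)
    show "C_k_on n K (dir_deriv u f)" using Suc.prems(2) by simp
    show "dir_deriv u f y = dir_deriv u g y" if "y \<in> K" for y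
      by (rule dir_deriv_cong[OF assms(1) that Suc.prems(1)])
  qed
  moreover have "g differentiable (at x)" if "x \<in> K" for x
    by (rule differentiable_at_cong[OF assms(1) that Suc.prems(1)]) (use Suc.prems(2) that in auto)
  ultimately show ?case by simp
qed

lemma smooth_on_cong:
  assumes "open K" "\<And>y. y \<in> K \<Longrightarrow> f y = g y" "smooth_on K f"
  shows "smooth_on K g"
  using assms C_k_on_cong unfolding smooth_on_def by metis

lemma smooth_on_dir_deriv: "smooth_on K f \<Longrightarrow> smooth_on K (dir_deriv u f)"
  unfolding smooth_on_def using C_k_on.simps(2) by blast

lemma smooth_on_differentiable: "smooth_on K f \<Longrightarrow> x \<in> K \<Longrightarrow> f differentiable (at x)"
  unfolding smooth_on_def using C_k_on.simps(2) by blast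

lemma smooth_on_has_derivative:
  assumes "smooth_on K f" "x \<in> K"
  shows "(f has_derivative (\<lambda>u. dir_deriv u f x)) (at x)"
proof -
  have "f differentiable (at x)" using smooth_on_differentiable[OF assms] .
  moreover have "(\<lambda>u. dir_deriv u f x) = frechet_derivative f (at x)"
    using dir_deriv_eq_frechet_derivative[OF calculation] by auto
  ultimately show ?thesis by (simp add: frechet_derivative_works)
qed

lemma smooth_on_foldr_dir_deriv: "smooth_on K f \<Longrightarrow> smooth_on K (foldr dir_deriv us f)"
  by (induction us) (auto intro: smooth_on_dir_deriv)

text \<open>Differentiation never leaves \<open>S\<close>, so induction on the order, run for all
  members of \<open>S\<close> at once, gives every \<open>C_k_on n\<close>. Derivatives need to
  match a member only on \<open>K\<close>, because nothing is controlled outside it.\<close>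

lemma smooth_on_coinduct:
  assumes "open K" "S f"
    and "\<And>h x. S h \<Longrightarrow> x \<in> K \<Longrightarrow> h differentiable (at x)"
    and "\<And>h u. S h \<Longrightarrow> \<exists>h'. S h' \<and> (\<forall>x\<in>K. dir_deriv u h x = h' x)"
  shows "smooth_on K f"
proof -
  have "C_k_on n K h" if "S h" for n h
    using that
  proof (induction n arbitrary: h)
    case 0
    then show ?case
      using assms(3) by (auto intro!: continuous_at_imp_continuous_on
          differentiable_imp_continuous_within)
  next
    case (Suc n)
    have "C_k_on n K (dir_deriv u h)" for u
    proof -
      obtain h' where h': "S h'" "\<forall>x\<in>K. dir_deriv u h x = h' x"
        using assms(4)[OF Suc.prems, of u] by blast
      then show ?thesis
        using C_k_on_cong[OF assms(1), of h' "dir_deriv u h" n] Suc.IH by metis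
    qed
    then show ?case using assms(3) Suc.prems by simp
  qed
  then show ?thesis using assms(2) unfolding smooth_on_def by blast
qed

section \<open>Smoothness of constants, the last coordinate, sums and products\<close>

lemma smooth_on_const:
  assumes "open K"
  shows "smooth_on K (\<lambda>x. c)"
proof (rule smooth_on_coinduct[where S = "\<lambda>h. \<exists>c. h = (\<lambda>x. c)"])
  fix h u assume "\<exists>c. h = (\<lambda>x::'a. c::real)"
  then show "\<exists>h'. (\<exists>c. h' = (\<lambda>x. c)) \<and> (\<forall>x\<in>K. dir_deriv u h x = h' x)"
    by (auto simp: dir_deriv_def)
qed (use assms in auto)

lemma smooth_on_snd:
  assumes "open K"
  shows "smooth_on K (snd :: _ \<times> real \<Rightarrow> real)"
\<comment> \<open>The constants join the invariant because they are the derivatives of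
  \<open>snd\<close>.\<close>
proof (rule smooth_on_coinduct[where S = "\<lambda>h. h = snd \<or> (\<exists>c. h = (\<lambda>x. c))"])
  fix h :: "'a \<times> real \<Rightarrow> real" and u
  assume "h = snd \<or> (\<exists>c. h = (\<lambda>x. c))"
  moreover have "dir_deriv u snd = (\<lambda>x::'a \<times> real. snd u)"
    by (intro ext dir_deriv_eq) (auto intro!: derivative_eq_intros)
  moreover have "dir_deriv u (\<lambda>x::'a \<times> real. c) = (\<lambda>x. 0)" for c
    by (auto simp: dir_deriv_def)
  ultimately have "\<exists>c. dir_deriv u h = (\<lambda>x. c)" by auto
  then show "\<exists>h'. (h' = snd \<or> (\<exists>c. h' = (\<lambda>x. c))) \<and> (\<forall>x\<in>K. dir_deriv u h x = h' x)"
    by blast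
next
  fix h :: "'a \<times> real \<Rightarrow> real" and x :: "'a \<times> real"
  assume "h = snd \<or> (\<exists>c. h = (\<lambda>x. c))"
  moreover have "(snd :: 'a \<times> real \<Rightarrow> real) differentiable at x"
    unfolding differentiable_def by (auto intro!: exI derivative_eq_intros)
  ultimately show "h differentiable at x" by auto
qed (use assms in auto)

lemma dir_deriv_add:
  assumes "f differentiable (at x)" "g differentiable (at x)"
  shows "dir_deriv u (\<lambda>x. f x + g x) x = dir_deriv u f x + dir_deriv u g x"
proof -
  obtain F G where "(f has_derivative F) (at x)" "(g has_derivative G) (at x)"
    using assms unfolding differentiable_def by blast
  from dir_deriv_eq[OF has_derivative_add[OF this]] dir_deriv_eq[OF this(1)] dir_deriv_eq[OF this(2)]
  show ?thesis by simp
qed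

lemma dir_deriv_mult:
  assumes "f differentiable (at x)" "g differentiable (at x)"
  shows "dir_deriv u (\<lambda>x. f x * g x) x = dir_deriv u f x * g x + f x * dir_deriv u g x"
proof -
  obtain F G where "(f has_derivative F) (at x)" "(g has_derivative G) (at x)"
    using assms unfolding differentiable_def by blast
  from dir_deriv_eq[OF has_derivative_mult[OF this]] dir_deriv_eq[OF this(1)] dir_deriv_eq[OF this(2)]
  show ?thesis by (simp add: algebra_simps)
qed

lemma C_k_on_add:
  assumes "open K" "C_k_on n K f" "C_k_on n K g"
  shows "C_k_on n K (\<lambda>x. f x + g x)"
  using assms(2,3)
proof (induction n arbitrary: f g)
  case 0
  then show ?case by (auto intro: continuous_on_add)
next
  case (Suc n)
  have f: "\<And>x. x \<in> K \<Longrightarrow> f differentiable (at x)" "\<And>u. C_k_on n K (dir_deriv u f)"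
    and g: "\<And>x. x \<in> K \<Longrightarrow> g differentiable (at x)" "\<And>u. C_k_on n K (dir_deriv u g)"
    using Suc.prems by simp_all
  have "C_k_on n K (dir_deriv u (\<lambda>x. f x + g x))" for u
  proof (rule C_k_on_cong[OF assms(1)])
    show "C_k_on n K (\<lambda>x. dir_deriv u f x + dir_deriv u g x)"
      by (rule Suc.IH[OF f(2) g(2)])
    show "dir_deriv u f x + dir_deriv u g x = dir_deriv u (\<lambda>x. f x + g x) x" if "x \<in> K" for x
      by (rule dir_deriv_add[OF f(1)[OF that] g(1)[OF that], symmetric])
  qed
  then show ?case using f(1) g(1) by (simp add: differentiable_add)
qed

lemma C_k_on_mult:
  assumes "open K" "C_k_on n K f" "C_k_on n K g"
  shows "C_k_on n K (\<lambda>x. f x * g x)"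
  using assms(2,3)
proof (induction n arbitrary: f g)
  case 0
  then show ?case by (auto intro: continuous_on_mult)
next
  case (Suc n)
  have f: "\<And>x. x \<in> K \<Longrightarrow> f differentiable (at x)" "\<And>u. C_k_on n K (dir_deriv u f)"
    and g: "\<And>x. x \<in> K \<Longrightarrow> g differentiable (at x)" "\<And>u. C_k_on n K (dir_deriv u g)"
    using Suc.prems by simp_all
  have "C_k_on n K (dir_deriv u (\<lambda>x. f x * g x))" for u
  proof (rule C_k_on_cong[OF assms(1)])
    show "C_k_on n K (\<lambda>x. dir_deriv u f x * g x + f x * dir_deriv u g x)"
      by (rule C_k_on_add[OF assms(1)
            Suc.IH[OF f(2) C_k_on_SucD[OF Suc.prems(2)]]
            Suc.IH[OF C_k_on_SucD[OF Suc.prems(1)] g(2)]])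
    show "dir_deriv u f x * g x + f x * dir_deriv u g x = dir_deriv u (\<lambda>x. f x * g x) x"
      if "x \<in> K" for x
      by (rule dir_deriv_mult[OF f(1)[OF that] g(1)[OF that], symmetric])
  qed
  then show ?case using f(1) g(1) by (simp add: differentiable_mult)
qed

lemma smooth_on_add:
  "open K \<Longrightarrow> smooth_on K f \<Longrightarrow> smooth_on K g \<Longrightarrow> smooth_on K (\<lambda>x. f x + g x)"
  unfolding smooth_on_def using C_k_on_add by blast

lemma smooth_on_mult:
  "open K \<Longrightarrow> smooth_on K f \<Longrightarrow> smooth_on K g \<Longrightarrow> smooth_on K (\<lambda>x. f x * g x)"
  unfolding smooth_on_def using C_k_on_mult by blast

text \<open>For a word \<open>i\<close> over \<open>L\<close>, \<open>\<psi> i\<close> plays the role of the iterated partial derivative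
  \<open>(\<partial>\<^sub>i \<phi>)(a)\<close>. A list of pairs \<open>(P, i)\<close> stands for the sum of the \<open>P (\<partial>\<^sub>i \<phi>)(a)\<close>; its
  directional derivatives are again such lists, with coefficients not depending on \<open>\<psi>\<close>.\<close>

definition diff_system ::
    "'a::real_normed_vector set \<Rightarrow> 'l list \<Rightarrow> ('l \<Rightarrow> 'a \<Rightarrow> real) \<Rightarrow> ('l list \<Rightarrow> 'a \<Rightarrow> real) \<Rightarrow> bool" where
  "diff_system K L a \<psi> \<longleftrightarrow>
     (\<forall>x\<in>K. \<forall>i. (\<psi> i has_derivative
        (\<lambda>h. \<Sum>l\<leftarrow>L. dir_deriv h (a l) x * \<psi> (l # i) x)) (at x))"

definition term_val ::
    "(('a \<Rightarrow> real) \<times> 'l list) list \<Rightarrow> ('l list \<Rightarrow> 'a \<Rightarrow> real) \<Rightarrow> 'a \<Rightarrow> real" where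
  "term_val ts \<psi> x = (\<Sum>(P, i)\<leftarrow>ts. P x * \<psi> i x)"

text \<open>Product and chain rule for one summand \<open>P (\<partial>_i \<phi>)(a)\<close>: the
  head differentiates the coefficient, the tail takes one further partial derivative of
  \<open>\<phi>\<close> for each letter.\<close>

definition term_deriv ::
    "'l list \<Rightarrow> ('l \<Rightarrow> 'a::real_normed_vector \<Rightarrow> real) \<Rightarrow> 'a \<Rightarrow>
     (('a \<Rightarrow> real) \<times> 'l list) list \<Rightarrow> (('a \<Rightarrow> real) \<times> 'l list) list" where
  "term_deriv L a u ts = concat (map (\<lambda>(P, i). (dir_deriv u P, i) #
     map (\<lambda>l. (\<lambda>x. P x * dir_deriv u (a l) x, l # i)) L) ts)"

lemma term_deriv_smooth:
  assumes "open K" "\<And>l. l \<in> set L \<Longrightarrow> smooth_on K (a l)" "\<forall>(P, i)\<in>set ts. smooth_on K P"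
  shows "\<forall>(P, i)\<in>set (term_deriv L a u ts). smooth_on K P"
  using assms by (fastforce simp: term_deriv_def intro!: smooth_on_mult smooth_on_dir_deriv)

lemma term_val_deriv:
  assumes "diff_system K L a \<psi>" "\<forall>(P, i)\<in>set ts. smooth_on K P" "x \<in> K"
  shows "(term_val ts \<psi> has_derivative (\<lambda>u. term_val (term_deriv L a u ts) \<psi> x)) (at x)"
  using assms(2)
proof (induction ts)
  case Nil
  then show ?case by (simp add: term_val_def[abs_def] term_deriv_def)
next
  case (Cons p ts)
  obtain P i where p: "p = (P, i)" by fastforce
  have "(\<psi> i has_derivative (\<lambda>h. \<Sum>l\<leftarrow>L. dir_deriv h (a l) x * \<psi> (l # i) x)) (at x)"
    using assms(1,3) by (auto simp: diff_system_def)
  moreover have "(P has_derivative (\<lambda>u. dir_deriv u P x)) (at x)"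
    using Cons.prems p assms(3) by (auto intro: smooth_on_has_derivative)
  ultimately have "((\<lambda>x. P x * \<psi> i x + term_val ts \<psi> x) has_derivative
      (\<lambda>u. (P x * (\<Sum>l\<leftarrow>L. dir_deriv u (a l) x * \<psi> (l # i) x) + dir_deriv u P x * \<psi> i x)
         + term_val (term_deriv L a u ts) \<psi> x)) (at x)"
    using Cons by (intro has_derivative_add has_derivative_mult) auto
  moreover have "(\<lambda>x. P x * \<psi> i x + term_val ts \<psi> x) = term_val (p # ts) \<psi>"
    by (auto simp: p term_val_def)
  moreover have "(\<lambda>u. (P x * (\<Sum>l\<leftarrow>L. dir_deriv u (a l) x * \<psi> (l # i) x) + dir_deriv u P x * \<psi> i x)
         + term_val (term_deriv L a u ts) \<psi> x) = (\<lambda>u. term_val (term_deriv L a u (p # ts)) \<psi> x)"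
    by (auto simp: p term_val_def term_deriv_def o_def sum_list_const_mult[symmetric]
      algebra_simps)
  ultimately show ?case by simp
qed

lemma foldr_term_deriv_smooth:
  assumes "open K" "\<And>l. l \<in> set L \<Longrightarrow> smooth_on K (a l)" "\<forall>(P, i)\<in>set ts. smooth_on K P"
  shows "\<forall>(P, i)\<in>set (foldr (term_deriv L a) us ts). smooth_on K P"
proof (induction us)
  case (Cons u us)
  then show ?case using term_deriv_smooth[of K L a _ u, OF assms(1,2)] by simp
qed (use assms(3) in simp)

text \<open>The purpose of the term calculus: the list on the right does not involve
  \<open>\<psi>\<close>. Hence whatever commutes with finite linear combinations of the
  \<open>\<psi> i x\<close>, such as limits and integrals, commutes with iterated directional
  derivatives.\<close>

lemma foldr_dir_deriv_term_val:
  assumes "open K" "\<And>l. l \<in> set L \<Longrightarrow> smooth_on K (a l)" "\<forall>(P, i)\<in>set ts. smooth_on K P"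
    and "diff_system K L a \<psi>" "x \<in> K"
  shows "foldr dir_deriv us (term_val ts \<psi>) x = term_val (foldr (term_deriv L a) us ts) \<psi> x"
  using assms(5)
proof (induction us arbitrary: x)
  case (Cons u us)
  have "dir_deriv u (foldr dir_deriv us (term_val ts \<psi>)) x
      = dir_deriv u (term_val (foldr (term_deriv L a) us ts) \<psi>) x"
    using Cons by (intro dir_deriv_cong[OF assms(1)]) auto
  also have "\<dots> = term_val (term_deriv L a u (foldr (term_deriv L a) us ts)) \<psi> x"
    using term_val_deriv[OF assms(4) foldr_term_deriv_smooth[OF assms(1-3)] Cons.prems]
    by (rule dir_deriv_eq)
  finally show ?case by simp
qed simp

lemma smooth_on_term_val:
  assumes "open K" "\<And>l. l \<in> set L \<Longrightarrow> smooth_on K (a l)" "\<forall>(P, i)\<in>set ts. smooth_on K P"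
    and "diff_system K L a \<psi>"
  shows "smooth_on K (term_val ts \<psi>)"
proof (rule smooth_on_coinduct[where
      S = "\<lambda>h. \<exists>ts. (\<forall>(P, i)\<in>set ts. smooth_on K P) \<and> h = term_val ts \<psi>"])
  fix h x assume "\<exists>ts. (\<forall>(P, i)\<in>set ts. smooth_on K P) \<and> h = term_val ts \<psi>" "x \<in> K"
  then show "h differentiable at x"
    using term_val_deriv[OF assms(4)] unfolding differentiable_def by blast
next
  fix h u assume "\<exists>ts. (\<forall>(P, i)\<in>set ts. smooth_on K P) \<and> h = term_val ts \<psi>"
  then obtain ts where ts: "\<forall>(P, i)\<in>set ts. smooth_on K P" "h = term_val ts \<psi>" by blast
  then show "\<exists>h'. (\<exists>ts. (\<forall>(P, i)\<in>set ts. smooth_on K P) \<and> h' = term_val ts \<psi>) \<and>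
      (\<forall>x\<in>K. dir_deriv u h x = h' x)"
    using term_deriv_smooth[of K L a ts u, OF assms(1,2) ts(1)]
      dir_deriv_eq[OF term_val_deriv[OF assms(4) ts(1)], of _ u]
    by (intro exI[of _ "term_val (term_deriv L a u ts) \<psi>"]) blast
qed (use assms in auto)

text \<open>For an outer function of one variable the alphabet has a single letter, and a word only
  counts derivatives; \<open>\<phi> j\<close> is the \<open>j\<close>-th derivative of
  \<open>\<phi> 0\<close>.\<close>

lemma diff_system_compose:
  assumes "\<And>x j. x \<in> K \<Longrightarrow> (\<phi> j has_real_derivative \<phi> (Suc j) (f x)) (at (f x))"
    and "smooth_on K f"
  shows "diff_system K [()] (\<lambda>_. f) (\<lambda>i x. \<phi> (length i) (f x))"
  unfolding diff_system_def
proof (intro ballI allI)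
  fix x :: 'a and i :: "unit list" assume x: "x \<in> K"
  show "((\<lambda>x. \<phi> (length i) (f x)) has_derivative
      (\<lambda>h. \<Sum>l\<leftarrow>[()]. dir_deriv h f x * \<phi> (length (l # i)) (f x))) (at x)"
    using has_derivative_compose[OF smooth_on_has_derivative[OF assms(2) x]
        has_field_derivative_imp_has_derivative[OF assms(1)[OF x]], of "length i"]
    by (simp add: mult.commute)
qed

lemma smooth_on_compose:
  assumes "open K" "smooth_on K f"
    and "\<And>x j. x \<in> K \<Longrightarrow> (\<phi> j has_real_derivative \<phi> (Suc j) (f x)) (at (f x))"
  shows "smooth_on K (\<lambda>x. \<phi> 0 (f x))"
proof -
  have sys: "diff_system K [()] (\<lambda>_. f) (\<lambda>i x. \<phi> (length i) (f x))"
    by (rule diff_system_compose[of K \<phi> f]) (rule assms(3) assms(2), assumption?)+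
  have "smooth_on K (term_val [(\<lambda>_. 1, [] :: unit list)] (\<lambda>i x. \<phi> (length i) (f x)))"
  proof (rule smooth_on_term_val[OF assms(1) _ _ sys])
    show "smooth_on K f" by (rule assms(2))
    show "\<forall>(P, i)\<in>set [(\<lambda>_. 1, [] :: unit list)]. smooth_on K P"
      using smooth_on_const[OF assms(1)] by simp
  qed
  then show ?thesis by (simp add: term_val_def[abs_def])
qed

lemma smooth_on_powr:
  assumes "open K" "smooth_on K f" "\<And>x. x \<in> K \<Longrightarrow> f x > 0"
  shows "smooth_on K (\<lambda>x. f x powr \<gamma>)"
proof -
  \<comment> \<open>The \<open>j\<close>-th derivative of \<open>s powr \<gamma>\<close>; the
    product is a falling factorial.\<close>
  define \<phi> where "\<phi> = (\<lambda>j s. (\<Prod>k<j. \<gamma> - real k) * s powr (\<gamma> - real j))"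
  have "(\<phi> j has_real_derivative \<phi> (Suc j) s) (at s)" if "s > 0" for j s
    using DERIV_cmult[OF has_real_derivative_powr[OF that, of "\<gamma> - real j"],
        of "\<Prod>k<j. \<gamma> - real k"]
    by (simp add: \<phi>_def mult.assoc diff_diff_eq add.commute)
  then have "smooth_on K (\<lambda>x. \<phi> 0 (f x))"
    using assms(3) by (intro smooth_on_compose[where \<phi> = \<phi>, OF assms(1,2)]) blast
  then show ?thesis by (simp add: \<phi>_def)
qed

lemma smooth_on_exp:
  assumes "open K" "smooth_on K f"
  shows "smooth_on K (\<lambda>x. exp (f x))"
  by (rule smooth_on_compose[OF assms, where \<phi> = "\<lambda>_. exp"]) (rule DERIV_exp)

section \<open>Complete monotonicity along a set of directions\<close>

definition cm_along :: "'a::real_normed_vector set \<Rightarrow> 'a set \<Rightarrow> ('a \<Rightarrow> real) \<Rightarrow> bool" where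
  "cm_along U K f \<longleftrightarrow> smooth_on K f \<and>
     (\<forall>us. set us \<subseteq> U \<longrightarrow> (\<forall>x\<in>K. (-1) ^ length us * foldr dir_deriv us f x \<ge> 0))"

lemma cm_alongD:
  assumes "cm_along U K f" "set us \<subseteq> U" "x \<in> K"
  shows "0 \<le> (-1) ^ length us * foldr dir_deriv us f x"
  using assms by (simp add: cm_along_def)

lemma completely_monotone_on_iff: "completely_monotone_on K f \<longleftrightarrow> cm_along K K f"
  by (simp add: completely_monotone_on_def cm_along_def)

text \<open>Sums and scalar multiples in one rule: a multiple is treated as the case
  \<open>d = 0\<close>.\<close>

lemma foldr_dir_deriv_lincomb:
  assumes K: "open K" and f: "smooth_on K f" and g: "smooth_on K g" and "x \<in> K"
  shows "foldr dir_deriv us (\<lambda>x. c * f x + d * g x) x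
    = c * foldr dir_deriv us f x + d * foldr dir_deriv us g x"
  using assms(4)
proof (induction us arbitrary: x)
  case (Cons u us)
  let ?f = "foldr dir_deriv us f" and ?g = "foldr dir_deriv us g"
  have "dir_deriv u (foldr dir_deriv us (\<lambda>x. c * f x + d * g x)) x
      = dir_deriv u (\<lambda>x. c * ?f x + d * ?g x) x"
    by (rule dir_deriv_cong[OF K Cons.prems Cons.IH])
  also have "\<dots> = c * dir_deriv u ?f x + d * dir_deriv u ?g x"
    by (rule dir_deriv_eq)
      (intro has_derivative_add has_derivative_mult_right smooth_on_has_derivative[OF _ Cons.prems]
        smooth_on_foldr_dir_deriv f g)
  finally show ?case by simp
qed simp

lemma nonneg_if_add_eps:
  fixes a b :: real
  assumes "\<And>e. e > 0 \<Longrightarrow> a + e * b \<ge> 0"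
  shows "a \<ge> 0"
proof (rule ccontr)
  assume "\<not> a \<ge> 0"
  then have a: "a < 0" by simp
  \<comment> \<open>Chosen so that \<open>e * b \<le> - a / 2\<close>, whence
    \<open>a + e * b \<le> a / 2 < 0\<close>.\<close>
  define e where "e = - a / (2 * (\<bar>b\<bar> + 1))"
  have "e > 0" using a by (simp add: e_def divide_neg_pos)
  moreover have "e * b \<le> e * (\<bar>b\<bar> + 1)" using \<open>e > 0\<close> by (intro mult_left_mono) auto
  moreover have "e * (\<bar>b\<bar> + 1) = - a / 2" by (simp add: e_def field_simps)
  ultimately show False using assms[of e] a by linarith
qed

text \<open>The directions \<open>(u, 0)\<close> and \<open>(0, 1)\<close> of the Post--Widder argument lie only in the closure of
  the cone.\<close>

lemma cm_along_closure:
  assumes K: "open K" and f: "cm_along U K f" and v: "v \<in> U"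
  shows "cm_along {w. \<forall>e>0. w + e *\<^sub>R v \<in> U} K f"
proof -
  let ?W = "{w. \<forall>e>0. w + e *\<^sub>R v \<in> U}"
  have sm: "smooth_on K f" using f by (simp add: cm_along_def)
  \<comment> \<open>Induction removes the boundary directions \<open>ws\<close> one at a time. A
    direction \<open>w\<close> is perturbed to \<open>w + e v\<close>, which lies in
    \<open>U\<close> and moves into \<open>us\<close>; by linearity in the direction the sign
    survives as \<open>e\<close> tends to 0.\<close>
  have "(-1) ^ (length us + length ws) * foldr dir_deriv us (foldr dir_deriv ws f) x \<ge> 0"
    if "set ws \<subseteq> ?W" "set us \<subseteq> U" "x \<in> K" for us ws x
    using that
  proof (induction ws arbitrary: us)
    case Nil
    then show ?case using f by (simp add: cm_along_def)
  next
    case (Cons w ws)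
    let ?h = "foldr dir_deriv ws f"
    let ?s = "(-1) ^ (length us + length (w # ws)) :: real"
    have sh: "smooth_on K ?h" by (rule smooth_on_foldr_dir_deriv[OF sm])
    have "?s * foldr dir_deriv us (dir_deriv w ?h) x
        + e * (?s * foldr dir_deriv us (dir_deriv v ?h) x) \<ge> 0" if "e > 0" for e
    proof -
      have "0 \<le> (-1) ^ (length (us @ [w + e *\<^sub>R v]) + length ws)
          * foldr dir_deriv (us @ [w + e *\<^sub>R v]) ?h x"
        using Cons.prems that by (intro Cons.IH) auto
      also have "foldr dir_deriv (us @ [w + e *\<^sub>R v]) ?h x
          = foldr dir_deriv us (\<lambda>y. 1 * dir_deriv w ?h y + e * dir_deriv v ?h y) x"
      proof -
        have "dir_deriv (w + e *\<^sub>R v) ?h y = 1 * dir_deriv w ?h y + e * dir_deriv v ?h y"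
          if "y \<in> K" for y
        proof -
          have lin: "linear (\<lambda>u. dir_deriv u ?h y)"
            by (rule has_derivative_linear[OF smooth_on_has_derivative[OF sh that]])
          show ?thesis using linear_add[OF lin, of w "e *\<^sub>R v"] linear_cmul[OF lin, of e v] by simp
        qed
        from foldr_dir_deriv_cong[OF K Cons.prems(3) this]
        show ?thesis by (simp only: foldr_append foldr.simps o_apply id_apply)
      qed
      also have "\<dots> = 1 * foldr dir_deriv us (dir_deriv w ?h) x + e * foldr dir_deriv us (dir_deriv v ?h) x"
        by (rule foldr_dir_deriv_lincomb[OF K smooth_on_dir_deriv[OF sh] smooth_on_dir_deriv[OF sh]
              Cons.prems(3)])
      finally show ?thesis by (simp add: algebra_simps)
    qed
    from nonneg_if_add_eps[OF this] show ?case by simp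
  qed
  from this[where us = "[]"] sm show ?thesis by (simp add: cm_along_def)
qed

lemma cm_along_cong:
  assumes "open K" "\<And>x. x \<in> K \<Longrightarrow> f x = g x" "cm_along U K f"
  shows "cm_along U K g"
  unfolding cm_along_def
proof (intro conjI allI impI ballI)
  show "smooth_on K g"
    using assms(3) by (intro smooth_on_cong[OF assms(1,2)]) (simp_all add: cm_along_def)
  show "0 \<le> (-1) ^ length us * foldr dir_deriv us g x" if "set us \<subseteq> U" "x \<in> K" for us x
    using cm_alongD[OF assms(3) that] by (simp only: foldr_dir_deriv_cong[OF assms(1) that(2) assms(2)])
qed

lemma cm_along_scale:
  assumes K: "open K" and c: "c \<ge> 0" and f: "cm_along U K f"
  shows "cm_along U K (\<lambda>x. c * f x)"
  unfolding cm_along_def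
proof (intro conjI allI impI ballI)
  have sm: "smooth_on K f" using f by (simp add: cm_along_def)
  show "smooth_on K (\<lambda>x. c * f x)" by (intro smooth_on_mult smooth_on_const K sm)
  fix us x assume us: "set us \<subseteq> U" and x: "x \<in> K"
  have "0 \<le> c * ((-1) ^ length us * foldr dir_deriv us f x)"
    by (intro mult_nonneg_nonneg c cm_alongD[OF f us x])
  then show "0 \<le> (-1) ^ length us * foldr dir_deriv us (\<lambda>x. c * f x) x"
    using foldr_dir_deriv_lincomb[OF K sm sm x, of us c 0] by (simp add: mult.left_commute)
qed

lemma cm_along_neg_deriv:
  assumes K: "open K" and f: "cm_along U K f" and u: "u \<in> U"
  shows "cm_along U K (\<lambda>x. - dir_deriv u f x)"
proof -
  have sm: "smooth_on K (dir_deriv u f)" using f by (simp add: cm_along_def smooth_on_dir_deriv)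
  have eq: "foldr dir_deriv us (\<lambda>x. - dir_deriv u f x) x = - foldr dir_deriv (us @ [u]) f x"
    if "x \<in> K" for us x
    using foldr_dir_deriv_lincomb[OF K sm sm that, of us "-1" 0] by simp
  have "smooth_on K (\<lambda>x. (-1) * dir_deriv u f x)"
    by (intro smooth_on_mult K sm smooth_on_const)
  moreover have "0 \<le> (-1) ^ length us * foldr dir_deriv us (\<lambda>x. - dir_deriv u f x) x"
    if "set us \<subseteq> U" "x \<in> K" for us x
  proof -
    have "set (us @ [u]) \<subseteq> U" using that u by simp
    then have "0 \<le> (-1) ^ length (us @ [u]) * foldr dir_deriv (us @ [u]) f x"
      using f that(2) unfolding cm_along_def by blast
    then show ?thesis by (simp add: eq[OF that(2)])
  qed
  ultimately show ?thesis by (simp add: cm_along_def)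
qed

text \<open>By Leibniz, \<open>-D_u (f g)\<close> is \<open>(-D_u f) g + f (-D_u g)\<close>, and
  \<open>-D_u f\<close>, \<open>-D_u g\<close> are again in the class. The innermost derivative is
  the last list entry, hence the induction from the right.\<close>

lemma cm_along_mult:
  assumes K: "open K" and f: "cm_along U K f" and g: "cm_along U K g"
  shows "cm_along U K (\<lambda>x. f x * g x)"
proof -
  have "0 \<le> (-1) ^ length us * foldr dir_deriv us (\<lambda>x. f x * g x) x"
    if "set us \<subseteq> U" "x \<in> K" "cm_along U K f" "cm_along U K g" for us x f g
    using that
  proof (induction us arbitrary: f g rule: rev_induct)
    case Nil
    then have "set [] \<subseteq> U \<longrightarrow> 0 \<le> f x" "set [] \<subseteq> U \<longrightarrow> 0 \<le> g x"
      unfolding cm_along_def by (metis foldr.simps(1) id_apply list.size(3) mult_1 power_0)+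
    then show ?case by simp
  next
    case (snoc u us)
    let ?f = "\<lambda>x. - dir_deriv u f x" and ?g = "\<lambda>x. - dir_deriv u g x"
    have u: "u \<in> U" and us: "set us \<subseteq> U" using snoc.prems by auto
    have f': "cm_along U K ?f" and g': "cm_along U K ?g"
      using cm_along_neg_deriv[OF K _ u] snoc.prems by auto
    have sm: "smooth_on K f" "smooth_on K g" "smooth_on K ?f" "smooth_on K ?g"
      using f' g' snoc.prems by (auto simp: cm_along_def)
    have "foldr dir_deriv (us @ [u]) (\<lambda>x. f x * g x) x
        = foldr dir_deriv us (\<lambda>x. (-1) * (?f x * g x) + (-1) * (f x * ?g x)) x"
    proof -
      have "dir_deriv u (\<lambda>x. f x * g x) y = (-1) * (?f y * g y) + (-1) * (f y * ?g y)"
        if "y \<in> K" for y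
        using dir_deriv_mult[OF smooth_on_differentiable[OF sm(1) that]
            smooth_on_differentiable[OF sm(2) that]] by simp
      from foldr_dir_deriv_cong[OF K \<open>x \<in> K\<close> this] show ?thesis by simp
    qed
    also have "\<dots> = (-1) * foldr dir_deriv us (\<lambda>x. ?f x * g x) x
        + (-1) * foldr dir_deriv us (\<lambda>x. f x * ?g x) x"
      by (rule foldr_dir_deriv_lincomb[OF K smooth_on_mult[OF K sm(3,2)]
            smooth_on_mult[OF K sm(1,4)] \<open>x \<in> K\<close>])
    finally have expand: "foldr dir_deriv (us @ [u]) (\<lambda>x. f x * g x) x
      = (-1) * foldr dir_deriv us (\<lambda>x. ?f x * g x) x
        + (-1) * foldr dir_deriv us (\<lambda>x. f x * ?g x) x" .
    have "(-1) ^ length (us @ [u]) * foldr dir_deriv (us @ [u]) (\<lambda>x. f x * g x) x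
      = (-1) ^ length us * foldr dir_deriv us (\<lambda>x. ?f x * g x) x
        + (-1) ^ length us * foldr dir_deriv us (\<lambda>x. f x * ?g x) x"
      unfolding expand by (simp add: right_diff_distrib)
    then show ?case
      using snoc.IH[OF us \<open>x \<in> K\<close> f' snoc.prems(4)] snoc.IH[OF us \<open>x \<in> K\<close> snoc.prems(3) g']
      by simp
  qed
  then show ?thesis
    using f g K unfolding cm_along_def by (auto intro!: smooth_on_mult)
qed

text \<open>Each derivative along \<open>u\<close> contributes the nonpositive factor
  \<open>- w * snd u\<close>.\<close>

lemma cm_along_exp_snd:
  fixes K :: "('a::real_normed_vector \<times> real) set"
  assumes K: "open K" and w: "w \<ge> 0" and U: "\<And>u. u \<in> U \<Longrightarrow> snd u \<ge> 0"
  shows "cm_along U K (\<lambda>p. exp (- (w * snd p)))"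
proof -
  have sm: "smooth_on K (\<lambda>p. exp (- w * snd p))"
    by (intro smooth_on_exp smooth_on_mult K smooth_on_const smooth_on_snd)
  have eq: "foldr dir_deriv us (\<lambda>p. exp (- (w * snd p)))
      = (\<lambda>p::'a \<times> real. (\<Prod>u\<leftarrow>us. - w * snd u) * exp (- (w * snd p)))" for us
  proof (induction us)
    case (Cons u us)
    have "dir_deriv u (\<lambda>p. c * exp (- (w * snd p))) p = - w * snd u * c * exp (- (w * snd p))" for c p
      by (rule dir_deriv_eq) (auto intro!: derivative_eq_intros)
    from this[of "\<Prod>u\<leftarrow>us. - w * snd u"] show ?case
      unfolding foldr.simps o_apply Cons by (simp add: fun_eq_iff)
  qed simp
  have "0 \<le> (-1) ^ length us * (\<Prod>u\<leftarrow>us. - w * snd u)" if "set us \<subseteq> U" for us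
    using that
  proof (induction us)
    case (Cons u us)
    then have "0 \<le> (w * snd u) * ((-1) ^ length us * (\<Prod>u\<leftarrow>us. - w * snd u))"
      using w U by (intro mult_nonneg_nonneg[of "w * snd u"]) auto
    then show ?case by (simp add: algebra_simps)
  qed simp
  then have "0 \<le> (-1) ^ length us * foldr dir_deriv us (\<lambda>p. exp (- (w * snd p))) p"
    if "set us \<subseteq> U" for us p
    using that by (simp add: eq mult.assoc[symmetric])
  then show ?thesis using sm by (simp add: cm_along_def)
qed

section \<open>Functions frozen at a fixed value of the last coordinate\<close>

lemma dir_deriv_section:
  fixes F :: "'a::real_normed_vector \<times> real \<Rightarrow> real"
  shows "dir_deriv u (\<lambda>p. F (fst p, c)) = (\<lambda>p. dir_deriv (fst u, 0) F (fst p, c))"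
  by (simp add: dir_deriv_def[abs_def])

text \<open>Frozen functions stay on the product space, so that all functions share one domain; the
  price is that the directions become \<open>(fst u, 0)\<close>, which may lie on the boundary of
  the cone.\<close>

lemma foldr_dir_deriv_section:
  fixes F :: "'a::real_normed_vector \<times> real \<Rightarrow> real"
  shows "foldr dir_deriv us (\<lambda>p. F (fst p, c))
    = (\<lambda>p. foldr dir_deriv (map (\<lambda>u. (fst u, 0)) us) F (fst p, c))"
  by (induction us) (simp_all add: dir_deriv_section)

lemma smooth_on_section:
  fixes F :: "'a::real_normed_vector \<times> real \<Rightarrow> real"
  assumes "open K" "smooth_on (K \<times> S) F" "c \<in> S" "open S"
  shows "smooth_on (K \<times> S) (\<lambda>p. F (fst p, c))"
proof (rule smooth_on_coinduct[where
      S = "\<lambda>h. \<exists>F. smooth_on (K \<times> S) F \<and> h = (\<lambda>p. F (fst p, c))"])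
  fix h :: "'a \<times> real \<Rightarrow> real" and x
  assume "\<exists>F. smooth_on (K \<times> S) F \<and> h = (\<lambda>p. F (fst p, c))" and x: "x \<in> K \<times> S"
  then obtain F where F: "smooth_on (K \<times> S) F" "h = (\<lambda>p. F (fst p, c))" by blast
  have "(F has_derivative (\<lambda>u. dir_deriv u F (fst x, c))) (at (fst x, c))"
    using smooth_on_has_derivative[OF F(1)] x assms(3) by auto
  moreover have "((\<lambda>p. (fst p, c)) has_derivative (\<lambda>u. (fst u, 0))) (at x)"
    by (auto intro!: derivative_eq_intros)
  ultimately show "h differentiable at x"
    using has_derivative_compose[of "\<lambda>p. (fst p, c)"] unfolding F(2) differentiable_def by blast
next
  fix h :: "'a \<times> real \<Rightarrow> real" and u
  assume "\<exists>F. smooth_on (K \<times> S) F \<and> h = (\<lambda>p. F (fst p, c))"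
  then show "\<exists>h'. (\<exists>F. smooth_on (K \<times> S) F \<and> h' = (\<lambda>p. F (fst p, c))) \<and>
      (\<forall>x\<in>K \<times> S. dir_deriv u h x = h' x)"
    using smooth_on_dir_deriv by (fastforce simp: dir_deriv_section)
qed (use assms in \<open>auto intro: open_Times\<close>)

text \<open>The sum is twice the midpoint.\<close>

lemma open_convex_cone_add:
  assumes "open_convex_cone K" "x \<in> K" "y \<in> K"
  shows "x + y \<in> K"
proof -
  have "(1/2) *\<^sub>R x + (1/2) *\<^sub>R y \<in> K"
    using assms unfolding open_convex_cone_def by (intro convexD) auto
  then have "2 *\<^sub>R ((1/2) *\<^sub>R x + (1/2) *\<^sub>R y) \<in> K"
    using assms unfolding open_convex_cone_def by (metis zero_less_numeral)
  then show ?thesis by (simp add: scaleR_add_right)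
qed

lemma tendsto_term_val:
  assumes "\<And>i. (\<lambda>n. \<psi> n i x) \<longlonglongrightarrow> \<psi>' i x"
  shows "(\<lambda>n. term_val ts (\<psi> n) x) \<longlonglongrightarrow> term_val ts \<psi>' x"
proof (induction ts)
  case (Cons p ts)
  then show ?case
    using assms by (cases p) (auto simp: term_val_def intro!: tendsto_intros)
qed (simp add: term_val_def)

section \<open>Post--Widder inversion\<close>

lemma dir_deriv_snd:
  fixes f :: "'a::real_normed_vector \<times> real \<Rightarrow> real"
  assumes "((\<lambda>y. f (x, y)) has_real_derivative d) (at y)"
  shows "dir_deriv (0, 1) f (x, y) = d"
proof -
  have "((\<lambda>t. f (x, y + t)) has_real_derivative d) (at 0)"
    using assms DERIV_shift[of "\<lambda>y. f (x, y)" d 0 y] by (simp add: add.commute)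
  then show ?thesis
    unfolding dir_deriv_def by (simp add: DERIV_imp_deriv)
qed

text \<open>These are, up to sign, the coefficients of the \<open>j\<close>-th derivative of
  \<open>(1 + t s / n)^(-b-n)\<close> in \<open>s\<close>; each new Pochhammer factor divided by
  \<open>n\<close> tends to 1.\<close>

lemma pochhammer_ratio_tendsto:
  fixes b :: real
  assumes "t \<longlonglongrightarrow> l"
  shows "(\<lambda>n. (t n / real n) ^ j * pochhammer (b + real n) j) \<longlonglongrightarrow> l ^ j"
proof (induction j)
  case (Suc j)
  have "(\<lambda>n. (b + real n + real j) / real n) \<longlonglongrightarrow> 1" by real_asymp
  from tendsto_mult[OF Suc.IH tendsto_mult[OF assms this]] show ?case
    by (simp add: pochhammer_Suc mult_ac)
qed simp

text \<open>Euler's limit. Replacing \<open>t\<close> by \<open>t + 1 / n\<close> leaves the limit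
  unchanged and keeps the parameter positive when \<open>t = 0\<close>.\<close>

lemma powr_tendsto_exp:
  fixes s t b :: real
  assumes "s > 0" "t \<ge> 0"
  shows "(\<lambda>n. (1 + (t + 1 / real n) / real n * s) powr (- b - real n)) \<longlonglongrightarrow> exp (- (t * s))"
  using assms by real_asymp

lemma DERIV_affine_powr:
  fixes a b r s :: real
  assumes "a + b * s > 0"
  shows "((\<lambda>s. (a + b * s) powr r) has_real_derivative r * (a + b * s) powr (r - 1) * b) (at s)"
  by (rule DERIV_chain2[where f = "\<lambda>z. z powr r" and g = "\<lambda>s. a + b * s", OF has_real_derivative_powr[OF assms]])
    (auto intro!: derivative_eq_intros)

text \<open>Both pairs \<open>(A, B)\<close> and \<open>(C, D)\<close> are instances, so the
  inversion is carried out once.\<close>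

locale affine_family =
  fixes K :: "'v::real_normed_vector set" and A B :: "'v \<Rightarrow> real" and \<beta> :: real
  assumes cone: "open_convex_cone K"
    and beta_pos: "\<beta> > 0"
    and A_pos: "\<And>x. x \<in> K \<Longrightarrow> A x > 0"
    and B_pos: "\<And>x. x \<in> K \<Longrightarrow> B x > 0"
    and cm: "completely_monotone_on (K \<times> {0<..}) (\<lambda>(x, y). (A x + B x * y) powr (-\<beta>))"
begin

abbreviation "F \<equiv> \<lambda>(x, y). (A x + B x * y) powr (-\<beta>)"

abbreviation "\<Omega> \<equiv> K \<times> {0::real<..}"

lemma open_K: "open K"
  using cone by (simp add: open_convex_cone_def)

lemma open_domain: "open \<Omega>"
  by (intro open_Times open_K) auto

lemma pos: "x \<in> K \<Longrightarrow> y > 0 \<Longrightarrow> A x + B x * y > 0"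
  using A_pos B_pos by (simp add: add_pos_pos)

text \<open>Smoothness of \<open>A\<close> and \<open>B\<close> has to be extracted from
  \<open>F\<close>: the power \<open>-1/\<beta>\<close> of a section of \<open>F\<close> is the
  affine function at \<open>y = c\<close>.\<close>

lemma smooth_affine:
  assumes "c > 0"
  shows "smooth_on \<Omega> (\<lambda>p. A (fst p) + B (fst p) * c)"
proof -
  have "smooth_on \<Omega> (\<lambda>p. F (fst p, c))"
    using cm assms open_K by (intro smooth_on_section) (auto simp: completely_monotone_on_def)
  then have "smooth_on \<Omega> (\<lambda>p. F (fst p, c) powr (- (1 / \<beta>)))"
    using pos assms by (intro smooth_on_powr open_domain) fastforce+
  then show ?thesis
    using pos[OF _ assms] beta_pos
    by (elim smooth_on_cong[OF open_domain, rotated]) (auto simp: powr_powr less_imp_le)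
qed

text \<open>The values of an affine function at 1 and 2 determine its slope and, in
  \<open>smooth_A\<close>, its intercept.\<close>

lemma smooth_B: "smooth_on \<Omega> (\<lambda>p. B (fst p))"
proof -
  have "smooth_on \<Omega> (\<lambda>p. (A (fst p) + B (fst p) * 2) + (-1) * (A (fst p) + B (fst p) * 1))"
    by (intro smooth_on_add smooth_on_mult smooth_on_const smooth_affine open_domain) auto
  then show ?thesis by (simp add: algebra_simps)
qed

lemma smooth_A: "smooth_on \<Omega> (\<lambda>p. A (fst p))"
proof -
  have "smooth_on \<Omega> (\<lambda>p. 2 * (A (fst p) + B (fst p) * 1) + (-1) * (A (fst p) + B (fst p) * 2))"
    by (intro smooth_on_add smooth_on_mult smooth_on_const smooth_affine open_domain) auto
  then show ?thesis by (simp add: algebra_simps)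
qed

lemma smooth_ratio: "smooth_on \<Omega> (\<lambda>p. A (fst p) / B (fst p))"
proof -
  have "smooth_on \<Omega> (\<lambda>p. A (fst p) * B (fst p) powr (-1))"
    using B_pos by (intro smooth_on_mult smooth_on_powr smooth_A smooth_B open_domain) auto
  then show ?thesis
    using B_pos
    by (elim smooth_on_cong[OF open_domain, rotated]) (auto simp: powr_minus_divide less_imp_le)
qed

lemma smooth_B_powr: "smooth_on \<Omega> (\<lambda>p. B (fst p) powr \<gamma>)"
  using B_pos by (intro smooth_on_powr smooth_B open_domain) auto

lemma snd_derivs:
  assumes "p \<in> \<Omega>"
  shows "foldr dir_deriv (replicate n (0, 1)) F p
    = (-1) ^ n * pochhammer \<beta> n * B (fst p) ^ n * (A (fst p) + B (fst p) * snd p) powr (-\<beta> - real n)"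
  using assms
proof (induction n arbitrary: p)
  case 0
  then show ?case by (cases p) simp
next
  case (Suc n)
  let ?G = "\<lambda>p. (-1) ^ n * pochhammer \<beta> n * B (fst p) ^ n
    * (A (fst p) + B (fst p) * snd p) powr (-\<beta> - real n)"
  obtain x y where p: "p = (x, y)" "x \<in> K" "y > 0" using Suc.prems by auto
  have "((\<lambda>y. ?G (x, y)) has_real_derivative (-1) ^ n * pochhammer \<beta> n * B x ^ n
      * ((-\<beta> - real n) * (A x + B x * y) powr (-\<beta> - real n - 1) * B x)) (at y)"
    using DERIV_cmult[OF DERIV_affine_powr[OF pos[OF p(2,3)], of "-\<beta> - real n"]] by simp
  from dir_deriv_snd[OF this] dir_deriv_cong[OF open_domain Suc.prems Suc.IH, where u = "(0, 1)"]
  show ?case by (simp add: p pochhammer_Suc algebra_simps)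
qed

text \<open>With \<open>v = (x, 1)\<close> the enlarged direction set contains \<open>(0, 1)\<close>
  and all \<open>(u, 0)\<close> with \<open>u\<close> in \<open>K\<close>.\<close>

lemma cm_along_F: "cm_along {w. \<forall>e>0. w + e *\<^sub>R (x, 1) \<in> \<Omega>} \<Omega> F" if "x \<in> K"
  using cm_along_closure[OF open_domain, of \<Omega> F "(x, 1)"] cm that
  by (simp add: completely_monotone_on_iff)

text \<open>Up to the factor \<open>(-1)^n * pochhammer \<beta> n\<close>, this is the
  \<open>n\<close>-th derivative of \<open>F\<close> in the last coordinate, frozen at
  \<open>c\<close>. Differentiating further along \<open>(fst u, 0)\<close> is covered by
  \<open>cm_along_F\<close>.\<close>

lemma cm_section:
  assumes "set us \<subseteq> \<Omega>" "p \<in> \<Omega>" "c > 0"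
  shows "0 \<le> (-1) ^ length us * foldr dir_deriv us
     (\<lambda>p. B (fst p) ^ n * (A (fst p) + B (fst p) * c) powr (-\<beta> - real n)) p"
proof -
  let ?G = "\<lambda>p. B (fst p) ^ n * (A (fst p) + B (fst p) * snd p) powr (-\<beta> - real n)"
  let ?ws = "map (\<lambda>u. (fst u, 0 :: real)) us"
  let ?x = "fst p"
  define k where "k = (-1) ^ n * pochhammer \<beta> n"
  have x: "?x \<in> K" and pc: "(?x, c) \<in> \<Omega>" using assms by auto
  \<comment> \<open>Adding \<open>e (x, 1)\<close> gives \<open>(u + e x, e)\<close> and
    \<open>(e x, 1 + e)\<close>, both in the open cone.\<close>
  have "set (?ws @ replicate n (0, 1)) \<subseteq> {w. \<forall>e>0. w + e *\<^sub>R (?x, 1) \<in> \<Omega>}"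
  proof -
    have "e *\<^sub>R ?x \<in> K" if "e > 0" for e using cone x that by (simp add: open_convex_cone_def)
    then show ?thesis using assms(1) open_convex_cone_add[OF cone] by auto
  qed
  from cm_alongD[OF cm_along_F[OF x] this pc]
  have "0 \<le> (-1) ^ length (?ws @ replicate n (0, 1))
      * foldr dir_deriv (?ws @ replicate n (0, 1)) F (?x, c)"
    .
  also have "foldr dir_deriv (?ws @ replicate n (0, 1)) F (?x, c)
      = foldr dir_deriv ?ws (\<lambda>p. k * ?G p + 0 * ?G p) (?x, c)"
  proof -
    have "foldr dir_deriv (replicate n (0, 1)) F q = k * ?G q + 0 * ?G q" if "q \<in> \<Omega>" for q
      by (simp only: snd_derivs[OF that] k_def mult.assoc mult_zero_left add_0_right)
    from foldr_dir_deriv_cong[OF open_domain pc this] show ?thesis by (simp only: foldr_append)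
  qed
  also have "\<dots> = k * foldr dir_deriv ?ws ?G (?x, c)"
  proof -
    have "smooth_on \<Omega> (\<lambda>p. A (fst p) + B (fst p) * snd p)"
      by (intro smooth_on_add smooth_on_mult smooth_A smooth_B smooth_on_snd open_domain)
    then have "smooth_on \<Omega> (\<lambda>p. (A (fst p) + B (fst p) * snd p) powr (-\<beta> - real n))"
      using pos by (intro smooth_on_powr open_domain) auto
    moreover have "smooth_on \<Omega> (\<lambda>p. B (fst p) ^ n)"
      using smooth_B_powr[of "real n"] B_pos
      by (elim smooth_on_cong[OF open_domain, rotated]) (auto simp: powr_realpow)
    ultimately have "smooth_on \<Omega> ?G" by (intro smooth_on_mult open_domain)
    from foldr_dir_deriv_lincomb[OF open_domain this this pc, of ?ws k 0] show ?thesis by simp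
  qed
  also have "foldr dir_deriv ?ws ?G (?x, c)
      = foldr dir_deriv us (\<lambda>p. B (fst p) ^ n * (A (fst p) + B (fst p) * c) powr (-\<beta> - real n)) p"
    using foldr_dir_deriv_section[of us ?G c] by simp
  \<comment> \<open>One sign \<open>(-1)^n\<close> counts the derivatives in the last coordinate,
    the other sits in \<open>k\<close>; they cancel.\<close>
  finally have "0 \<le> ((-1) ^ n * (-1) ^ n) * (pochhammer \<beta> n * ((-1) ^ length us * foldr dir_deriv us
     (\<lambda>p. B (fst p) ^ n * (A (fst p) + B (fst p) * c) powr (-\<beta> - real n)) p))"
    by (simp only: k_def power_add length_append length_map length_replicate mult_ac)
  moreover have "(-1) ^ n * (-1) ^ n = (1::real)"
    by (simp flip: power_mult_distrib)
  ultimately have "0 \<le> pochhammer \<beta> n * ((-1) ^ length us * foldr dir_deriv us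
     (\<lambda>p. B (fst p) ^ n * (A (fst p) + B (fst p) * c) powr (-\<beta> - real n)) p)"
    by (simp only: mult_1)
  then show ?thesis
    using pochhammer_pos[OF beta_pos, of n] by (simp add: zero_le_mult_iff)
qed

lemma smooth_exp_ratio: "smooth_on \<Omega> (\<lambda>p. B (fst p) powr (-\<beta>) * exp (- (t * (A (fst p) / B (fst p)))))"
proof -
  have "smooth_on \<Omega> (\<lambda>p. B (fst p) powr (-\<beta>) * exp ((-t) * (A (fst p) / B (fst p))))"
    by (intro smooth_on_mult smooth_on_exp smooth_on_const smooth_B_powr smooth_ratio open_domain)
  then show ?thesis by simp
qed

text \<open>Post-Widder: with \<open>a = A/B\<close>, the functions
  \<open>B^(-\<beta>) (1 + T_n a / n)^(-\<beta>-n)\<close> converge to the claimed one when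
  \<open>T_n\<close> tends to \<open>t\<close>, and each is a positive multiple of a section from
  \<open>cm_section\<close>. The term calculus carries the signs of the derivatives to the
  limit.\<close>

lemma cm_exp_ratio:
  assumes "t \<ge> 0"
  shows "cm_along \<Omega> \<Omega> (\<lambda>p. B (fst p) powr (-\<beta>) * exp (- (t * (A (fst p) / B (fst p)))))"
proof -
  let ?a = "\<lambda>p. A (fst p) / B (fst p)" and ?b = "\<lambda>p. B (fst p) powr (-\<beta>)"
  \<comment> \<open>The shift keeps \<open>n / T n\<close> meaningful at
    \<open>t = 0\<close>.\<close>
  define T where "T = (\<lambda>n. t + 1 / real n)"
  \<comment> \<open>\<open>\<phi> n j\<close> and, below, \<open>\<phi>' j\<close> are the
    \<open>j\<close>-th derivatives in \<open>s\<close> of the approximant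
    \<open>(1 + T n s / n)^(-\<beta>-n)\<close> and of its limit
    \<open>exp (- (t * s))\<close>.\<close>
  define \<phi> where "\<phi> = (\<lambda>n j s. (-1) ^ j * ((T n / real n) ^ j * pochhammer (\<beta> + real n) j)
    * (1 + T n / real n * s) powr (- (\<beta> + real j) - real n))"
  define \<phi>' where "\<phi>' = (\<lambda>j s. (-t) ^ j * exp (- (t * s)))"
  have T: "T n > 0" if "n > 0" for n using assms that by (simp add: T_def add_nonneg_pos)
  have T_lim: "T \<longlonglongrightarrow> t"
    unfolding T_def by real_asymp
  have deriv: "(\<phi> n j has_real_derivative \<phi> n (Suc j) s) (at s)" if "n > 0" "s > 0" for n j s
  proof -
    have p: "1 + T n / real n * s > 0"
      using T[OF that(1)] that by (intro add_pos_pos mult_pos_pos divide_pos_pos) auto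
    have "((\<lambda>s. (1 + T n / real n * s) powr (- (\<beta> + real j) - real n)) has_real_derivative
        (- (\<beta> + real j) - real n) * (1 + T n / real n * s) powr (- (\<beta> + real j) - real n - 1)
          * (T n / real n)) (at s)"
      by (rule DERIV_affine_powr[OF p])
    then have "(\<phi> n j has_real_derivative (-1) ^ j * ((T n / real n) ^ j * pochhammer (\<beta> + real n) j) *
        ((- (\<beta> + real j) - real n) * (1 + T n / real n * s) powr (- (\<beta> + real j) - real n - 1)
          * (T n / real n))) (at s)"
      unfolding \<phi>_def by (rule DERIV_cmult)
    moreover have "- (\<beta> + real (Suc j)) - real n = - (\<beta> + real j) - real n - 1" by simp
    moreover obtain d where "T n / real n = d" by simp
    ultimately show ?thesis
      unfolding \<phi>_def pochhammer_Suc power_Suc by (simp only:) (simp add: algebra_simps)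
  qed
  have deriv': "(\<phi>' j has_real_derivative \<phi>' (Suc j) s) (at s)" for j s
    unfolding \<phi>'_def by (auto intro!: derivative_eq_intros)
  have lim: "(\<lambda>n. \<phi> n j s) \<longlonglongrightarrow> \<phi>' j s" if "s > 0" for j s
  proof -
    have "(\<lambda>n. \<phi> n j s) \<longlonglongrightarrow> (-1) ^ j * t ^ j * exp (- (t * s))"
      unfolding \<phi>_def
      using powr_tendsto_exp[OF that assms, of "\<beta> + real j"]
      by (intro tendsto_mult tendsto_const pochhammer_ratio_tendsto T_lim) (simp add: T_def)
    then show ?thesis by (simp add: \<phi>'_def power_minus[of t])
  qed
  have ratio_pos: "?a p > 0" if "p \<in> \<Omega>" for p using A_pos B_pos that by auto
  have sys: "diff_system \<Omega> [()] (\<lambda>_. ?a) (\<lambda>i x. \<phi> n (length i) (?a x))" if "n > 0" for n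
    by (rule diff_system_compose[where \<phi> = "\<phi> n", OF deriv[OF that ratio_pos] smooth_ratio])
  have sys': "diff_system \<Omega> [()] (\<lambda>_. ?a) (\<lambda>i x. \<phi>' (length i) (?a x))"
    by (rule diff_system_compose[where \<phi> = \<phi>', OF deriv' smooth_ratio])
  have "0 \<le> (-1) ^ length us * foldr dir_deriv us (\<lambda>p. ?b p * exp (- (t * ?a p))) p"
    if us: "set us \<subseteq> \<Omega>" and p: "p \<in> \<Omega>" for us p
  proof -
    let ?start = "[(?b, [] :: unit list)]"
    let ?ts = "foldr (term_deriv [()] (\<lambda>_. ?a)) us ?start"
    have start: "\<forall>(P, i)\<in>set ?start. smooth_on \<Omega> P" using smooth_B_powr by simp
    have "0 \<le> (-1) ^ length us * term_val ?ts (\<lambda>i x. \<phi> n (length i) (?a x)) p" if n: "n > 0" for n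
    proof -
      \<comment> \<open>With this \<open>c\<close>, \<open>A + B c = c B (1 + T_n a / n)\<close>,
        and \<open>B^n B^(-\<beta>-n)\<close> collapses to \<open>B^(-\<beta>)\<close>.\<close>
      define c where "c = real n / T n"
      have c: "c > 0" using n T[OF n] by (simp add: c_def)
      let ?G = "\<lambda>p. B (fst p) ^ n * (A (fst p) + B (fst p) * c) powr (-\<beta> - real n)"
      let ?H = "term_val ?start (\<lambda>i x. \<phi> n (length i) (?a x))"
      have smH: "smooth_on \<Omega> ?H"
        by (rule smooth_on_term_val[OF open_domain _ start sys[OF n]]) (rule smooth_ratio)
      have eq: "?G q = c powr (-\<beta> - real n) * ?H q + 0 * ?H q" if "q \<in> \<Omega>" for q
      proof -
        have ab: "A (fst q) > 0" "B (fst q) > 0" using that A_pos B_pos by auto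
        have "A (fst q) + B (fst q) * c = c * (B (fst q) * (1 + T n / real n * ?a q))"
          using ab T[OF n] n by (simp add: c_def field_simps)
        then have "(A (fst q) + B (fst q) * c) powr (-\<beta> - real n) = c powr (-\<beta> - real n) *
            (B (fst q) powr (-\<beta> - real n) * (1 + T n / real n * ?a q) powr (-\<beta> - real n))"
          using ab c T[OF n] n by (simp only: powr_mult)
        moreover have "B (fst q) ^ n * B (fst q) powr (-\<beta> - real n) = ?b q"
          using ab by (simp add: powr_realpow[symmetric] powr_add[symmetric])
        ultimately show ?thesis
          by (simp add: term_val_def \<phi>_def mult_ac)
      qed
      have "0 \<le> (-1) ^ length us * foldr dir_deriv us ?G p"
        by (rule cm_section[OF us p c])
      also have "foldr dir_deriv us ?G p
          = foldr dir_deriv us (\<lambda>q. c powr (-\<beta> - real n) * ?H q + 0 * ?H q) p"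
        by (rule foldr_dir_deriv_cong[OF open_domain p eq])
      also have "\<dots> = c powr (-\<beta> - real n) * foldr dir_deriv us ?H p"
        using foldr_dir_deriv_lincomb[OF open_domain smH smH p, of us "c powr (-\<beta> - real n)" 0] by simp
      also have "foldr dir_deriv us ?H p = term_val ?ts (\<lambda>i x. \<phi> n (length i) (?a x)) p"
        by (rule foldr_dir_deriv_term_val[OF open_domain _ start sys[OF n] p]) (rule smooth_ratio)
      finally have "0 \<le> c powr (-\<beta> - real n) *
          ((-1) ^ length us * term_val ?ts (\<lambda>i x. \<phi> n (length i) (?a x)) p)"
        by (simp only: mult.left_commute)
      then show ?thesis using c by (simp add: zero_le_mult_iff)
    qed
    then have ev: "\<forall>\<^sub>F n in sequentially.
        0 \<le> (-1) ^ length us * term_val ?ts (\<lambda>i x. \<phi> n (length i) (?a x)) p"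
      by (auto intro: eventually_mono[OF eventually_gt_at_top[of 0]])
    have "(\<lambda>n. (-1) ^ length us * term_val ?ts (\<lambda>i x. \<phi> n (length i) (?a x)) p)
        \<longlonglongrightarrow> (-1) ^ length us * term_val ?ts (\<lambda>i x. \<phi>' (length i) (?a x)) p"
      by (intro tendsto_mult_left tendsto_term_val lim ratio_pos p)
    then have "0 \<le> (-1) ^ length us * term_val ?ts (\<lambda>i x. \<phi>' (length i) (?a x)) p"
      using ev by (rule tendsto_lowerbound) simp
    also have "term_val ?ts (\<lambda>i x. \<phi>' (length i) (?a x)) p
        = foldr dir_deriv us (term_val ?start (\<lambda>i x. \<phi>' (length i) (?a x))) p"
      by (rule foldr_dir_deriv_term_val[OF open_domain _ start sys' p, symmetric]) (rule smooth_ratio)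
    also have "term_val ?start (\<lambda>i x. \<phi>' (length i) (?a x)) = (\<lambda>p. ?b p * exp (- (t * ?a p)))"
      by (simp add: term_val_def[abs_def] \<phi>'_def)
    finally show ?thesis .
  qed
  then show ?thesis using smooth_exp_ratio by (simp add: cm_along_def)
qed

end

section \<open>Mixtures of exponentials\<close>

text \<open>\<open>\<phi> vs\<close> stands for an iterated derivative along the vectors
  \<open>vs\<close>. Expanding the derivative of \<open>q\<close> in the basis and using linearity
  in the newest direction leaves basis vectors as the letters.\<close>

lemma diff_system_inner:
  fixes q :: "'a::real_normed_vector \<Rightarrow> 'e::euclidean_space"
  assumes deriv: "\<And>x vs. x \<in> K \<Longrightarrow> (\<phi> vs has_derivative (\<lambda>h. \<phi> (h # vs) (q x))) (at (q x))"
    and q: "\<And>b. b \<in> Basis \<Longrightarrow> smooth_on K (\<lambda>x. q x \<bullet> b)"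
    and L: "distinct L" "set L = (Basis :: 'e set)"
  shows "diff_system K L (\<lambda>b x. q x \<bullet> b) (\<lambda>i x. \<phi> i (q x))"
  unfolding diff_system_def
proof (intro ballI allI)
  fix x i assume x: "x \<in> K"
  let ?D = "\<lambda>h. \<Sum>b\<in>Basis. dir_deriv h (\<lambda>x. q x \<bullet> b) x *\<^sub>R b"
  have "(q has_derivative ?D) (at x)"
  proof (subst has_derivative_componentwise_within, intro ballI)
    fix b :: 'e assume b: "b \<in> Basis"
    have "(\<lambda>h. ?D h \<bullet> b) = (\<lambda>h. dir_deriv h (\<lambda>x. q x \<bullet> b) x)"
      using b by (simp add: inner_sum_left inner_Basis if_distrib sum.delta cong: if_cong)
    then show "((\<lambda>x. q x \<bullet> b) has_derivative (\<lambda>h. ?D h \<bullet> b)) (at x)"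
      using smooth_on_has_derivative[OF q[OF b] x] by simp
  qed
  from has_derivative_compose[OF this deriv[OF x]]
  have "((\<lambda>x. \<phi> i (q x)) has_derivative (\<lambda>h. \<phi> (?D h # i) (q x))) (at x)" .
  moreover have "\<phi> (?D h # i) (q x) = (\<Sum>b\<leftarrow>L. dir_deriv h (\<lambda>x. q x \<bullet> b) x * \<phi> (b # i) (q x))" for h
  proof -
    have lin: "linear (\<lambda>h. \<phi> (h # i) (q x))"
      by (rule has_derivative_linear[OF deriv[OF x]])
    show ?thesis
      using linear_sum[OF lin, of "\<lambda>b. dir_deriv h (\<lambda>x. q x \<bullet> b) x *\<^sub>R b" Basis] linear_cmul[OF lin] L
      by (simp add: sum_list_distinct_conv_sum_set)
  qed
  ultimately show "((\<lambda>x. \<phi> i (q x)) has_derivative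
      (\<lambda>h. \<Sum>b\<leftarrow>L. dir_deriv h (\<lambda>x. q x \<bullet> b) x * \<phi> (b # i) (q x))) (at x)"
    by simp
qed

lemma integral_term_val:
  assumes "\<And>i. integrable M (\<lambda>w. \<psi> w i x)"
  shows "integrable M (\<lambda>w. term_val ts (\<psi> w) x)"
    and "term_val ts (\<lambda>i x. \<integral>w. \<psi> w i x \<partial>M) x = (\<integral>w. term_val ts (\<psi> w) x \<partial>M)"
proof -
  have "integrable M (\<lambda>w. term_val ts (\<psi> w) x) \<and>
    term_val ts (\<lambda>i x. \<integral>w. \<psi> w i x \<partial>M) x = (\<integral>w. term_val ts (\<psi> w) x \<partial>M)"
    by (induction ts) (use assms in \<open>auto simp: term_val_def\<close>)
  then show "integrable M (\<lambda>w. term_val ts (\<psi> w) x)"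
    and "term_val ts (\<lambda>i x. \<integral>w. \<psi> w i x \<partial>M) x = (\<integral>w. term_val ts (\<psi> w) x \<partial>M)" by auto
qed

text \<open>Second-order Taylor remainder in Lagrange form. The bound is monotone in
  \<open>s\<close>, so a Cauchy-Schwarz majorant may replace \<open>\<bar>r\<bar>\<close>.\<close>

lemma exp_remainder_bound:
  fixes r s :: real
  assumes "\<bar>r\<bar> \<le> s"
  shows "\<bar>exp r - 1 - r\<bar> \<le> s\<^sup>2 * exp s"
proof -
  have "exp r - 1 - r \<ge> 0" using exp_ge_add_one_self[of r] by linarith
  moreover have "exp r - 1 - r \<le> r\<^sup>2 * exp \<bar>r\<bar>"
  proof (cases "r = 0")
    case False
    obtain t where t: "\<bar>t\<bar> \<le> \<bar>r\<bar>" "exp r = (\<Sum>m<2. r ^ m / fact m) + exp t / fact 2 * r ^ 2"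
      using Maclaurin_exp_le[of r 2] by blast
    have "exp t / 2 \<le> exp \<bar>r\<bar>"
    proof -
      have "exp t \<le> exp \<bar>r\<bar>" using t(1) by simp
      then show ?thesis using exp_gt_zero[of t] by linarith
    qed
    then have "exp t / 2 * r\<^sup>2 \<le> exp \<bar>r\<bar> * r\<^sup>2" by (intro mult_right_mono) auto
    then show ?thesis using t(2) by (simp add: numeral_2_eq_2 mult.commute)
  qed simp
  moreover have "r\<^sup>2 * exp \<bar>r\<bar> \<le> s\<^sup>2 * exp s"
    using assms by (intro mult_mono) (auto simp: abs_le_square_iff[symmetric])
  ultimately show ?thesis by linarith
qed

text \<open>A mixture of exponentials whose exponents are parametrized by \<open>z\<close>, which
  spares a push-forward. \<open>M\<close> may be infinite, so integrability is asked only for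
  \<open>p\<close> with positive coordinates.\<close>

locale laplace_measure =
  fixes M :: "'w measure" and z :: "'w \<Rightarrow> 'e::euclidean_space"
  assumes z_meas [measurable]: "z \<in> borel_measurable M"
    and z_nonneg: "\<And>w b. w \<in> space M \<Longrightarrow> b \<in> Basis \<Longrightarrow> z w \<bullet> b \<ge> 0"
    and exp_integrable:
      "\<And>p. (\<And>b. b \<in> Basis \<Longrightarrow> p \<bullet> b > 0) \<Longrightarrow> integrable M (\<lambda>w. exp (- (p \<bullet> z w)))"
begin

text \<open>The iterated derivative of \<open>exp (- (p \<bullet> z w))\<close> in \<open>p\<close>
  along \<open>vs\<close>.\<close>

definition laplace_kernel :: "'w \<Rightarrow> 'e list \<Rightarrow> 'e \<Rightarrow> real" where
  "laplace_kernel w vs p = (\<Prod>v\<leftarrow>vs. - (z w \<bullet> v)) * exp (- (p \<bullet> z w))"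

definition orthant :: "'e set" where
  "orthant = {p. \<forall>b\<in>Basis. p \<bullet> b > 0}"

lemma kernel_meas [measurable]: "(\<lambda>w. laplace_kernel w vs p) \<in> borel_measurable M"
proof -
  have "(\<lambda>w. \<Prod>v\<leftarrow>vs. - (z w \<bullet> v)) \<in> borel_measurable M" by (induction vs) auto
  then show ?thesis unfolding laplace_kernel_def by measurable
qed

text \<open>Half the smallest coordinate is a margin of exponential decay that can be spent on
  absorbing polynomial factors.\<close>

lemma orthant_shift:
  assumes "p \<in> orthant"
  obtains e where "e > 0" "p - e *\<^sub>R One \<in> orthant"
proof -
  define e where "e = Min ((\<lambda>b. p \<bullet> b) ` Basis) / 2"
  have m: "Min ((\<lambda>b. p \<bullet> b) ` Basis) > 0" using assms by (subst Min_gr_iff) (auto simp: orthant_def)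
  then have e: "e > 0" by (simp add: e_def)
  moreover have "e < p \<bullet> b" if "b \<in> Basis" for b
  proof -
    have "Min ((\<lambda>b. p \<bullet> b) ` Basis) \<le> p \<bullet> b" using that by (intro Min_le) auto
    then show ?thesis using m by (simp add: e_def del: Min_le_iff Min_gr_iff)
  qed
  ultimately show ?thesis
    by (intro that[of e]) (auto simp: orthant_def inner_diff_left)
qed

lemma norm_le_One:
  assumes "w \<in> space M"
  shows "norm (z w) \<le> z w \<bullet> One"
proof -
  have "norm (z w) \<le> (\<Sum>b\<in>Basis. \<bar>z w \<bullet> b\<bar>)" by (rule norm_le_l1)
  also have "\<dots> = z w \<bullet> One" using z_nonneg[OF assms] by (simp add: inner_sum_right)
  finally show ?thesis .
qed

text \<open>Each factor \<open>z w \<bullet> v\<close> is at most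
  \<open>norm v / e * exp (e * (z w \<bullet> One))\<close>, which amounts to lowering
  \<open>p\<close> by \<open>e One\<close>.\<close>

lemma kernel_integrable:
  assumes "p \<in> orthant"
  shows "integrable M (\<lambda>w. laplace_kernel w vs p)"
  using assms
proof (induction vs arbitrary: p)
  case Nil
  then show ?case using exp_integrable[of p] by (simp add: laplace_kernel_def orthant_def)
next
  case (Cons v vs)
  obtain e where e: "e > 0" "p - e *\<^sub>R One \<in> orthant" using orthant_shift[OF Cons.prems] .
  show ?case
  proof (rule Bochner_Integration.integrable_bound)
    show "integrable M (\<lambda>w. norm v / e * laplace_kernel w vs (p - e *\<^sub>R One))"
      using Cons.IH[OF e(2)] by simp
    show "AE w in M. norm (laplace_kernel w (v # vs) p) \<le> norm (norm v / e * laplace_kernel w vs (p - e *\<^sub>R One))"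
    proof (rule AE_I2)
      fix w assume w: "w \<in> space M"
      let ?P = "\<bar>\<Prod>v\<leftarrow>vs. - (z w \<bullet> v)\<bar>"
      have "\<bar>z w \<bullet> v\<bar> \<le> norm (z w) * norm v" by (rule Cauchy_Schwarz_ineq2)
      also have "\<dots> \<le> (z w \<bullet> One) * norm v" using norm_le_One[OF w] by (intro mult_right_mono) auto
      also have "\<dots> = norm v / e * (e * (z w \<bullet> One))" using e by simp
      also have "\<dots> \<le> norm v / e * exp (e * (z w \<bullet> One))"
      proof (intro mult_left_mono)
        show "e * (z w \<bullet> One) \<le> exp (e * (z w \<bullet> One))"
          using exp_ge_add_one_self[of "e * (z w \<bullet> One)"] by linarith
      qed (use e in auto)
      finally have "\<bar>z w \<bullet> v\<bar> * (?P * exp (- (p \<bullet> z w)))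
          \<le> norm v / e * exp (e * (z w \<bullet> One)) * (?P * exp (- (p \<bullet> z w)))"
        by (intro mult_right_mono) auto
      also have "\<dots> = norm v / e * (?P * exp (- ((p - e *\<^sub>R One) \<bullet> z w)))"
      proof -
        have "exp (- ((p - e *\<^sub>R One) \<bullet> z w)) = exp (- (p \<bullet> z w)) * exp (e * (z w \<bullet> One))"
          by (simp add: inner_diff_left exp_add[symmetric] inner_commute[of One])
        then show ?thesis by (simp only: mult_ac)
      qed
      finally show "norm (laplace_kernel w (v # vs) p) \<le> norm (norm v / e * laplace_kernel w vs (p - e *\<^sub>R One))"
        using e by (simp add: laplace_kernel_def abs_mult mult_ac)
    qed
  qed simp
qed

lemma kernel_add:
  "laplace_kernel w vs (p + h) - laplace_kernel w vs p - laplace_kernel w (h # vs) p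
    = laplace_kernel w vs p * (exp (- (h \<bullet> z w)) - 1 - (- (h \<bullet> z w)))"
proof -
  have "exp (- ((p + h) \<bullet> z w)) = exp (- (p \<bullet> z w)) * exp (- (h \<bullet> z w))"
    by (simp add: inner_add_left exp_add[symmetric])
  then show ?thesis by (simp add: laplace_kernel_def algebra_simps inner_commute[of h])
qed

text \<open>The Taylor remainder costs a factor
  \<open>(z w \<bullet> One)^2 exp (e (z w \<bullet> One))\<close>. This is absorbed by two extra
  directions \<open>One\<close> and a shift of \<open>p\<close>, so the majorant is again a kernel
  and depends on \<open>h\<close> only through \<open>(norm h)^2\<close>.\<close>

lemma kernel_remainder:
  assumes w: "w \<in> space M" and h: "norm h \<le> e"
  shows "\<bar>laplace_kernel w vs (p + h) - laplace_kernel w vs p - laplace_kernel w (h # vs) p\<bar>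
    \<le> (norm h)\<^sup>2 * \<bar>laplace_kernel w (One # One # vs) (p - e *\<^sub>R One)\<bar>"
proof -
  let ?s = "z w \<bullet> One"
  have s: "0 \<le> ?s" "norm (z w) \<le> ?s" using norm_le_One[OF w] norm_ge_zero[of "z w"] by linarith+
  have "\<bar>- (h \<bullet> z w)\<bar> \<le> norm h * norm (z w)" using Cauchy_Schwarz_ineq2[of h "z w"] by simp
  also have "\<dots> \<le> norm h * ?s" using s by (intro mult_left_mono) auto
  finally have "\<bar>exp (- (h \<bullet> z w)) - 1 - (- (h \<bullet> z w))\<bar> \<le> (norm h * ?s)\<^sup>2 * exp (norm h * ?s)"
    by (rule exp_remainder_bound)
  also have "\<dots> \<le> (norm h * ?s)\<^sup>2 * exp (e * ?s)"
    using h s by (intro mult_left_mono) (auto intro: mult_right_mono)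
  finally have "\<bar>laplace_kernel w vs p\<bar> * \<bar>exp (- (h \<bullet> z w)) - 1 - (- (h \<bullet> z w))\<bar>
      \<le> \<bar>laplace_kernel w vs p\<bar> * ((norm h * ?s)\<^sup>2 * exp (e * ?s))"
    by (intro mult_left_mono) auto
  also have "\<dots> = (norm h)\<^sup>2 * \<bar>laplace_kernel w (One # One # vs) (p - e *\<^sub>R One)\<bar>"
  proof -
    have "exp (- ((p - e *\<^sub>R One) \<bullet> z w)) = exp (- (p \<bullet> z w)) * exp (e * ?s)"
      by (simp add: inner_diff_left exp_add[symmetric] inner_commute[of One])
    then show ?thesis
      using s by (simp add: laplace_kernel_def abs_mult power2_eq_square mult_ac)
  qed
  finally show ?thesis by (simp only: kernel_add abs_mult)
qed

lemma has_derivative_kernel: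
  "((laplace_kernel w vs) has_derivative (\<lambda>h. laplace_kernel w (h # vs) p)) (at p)"
  unfolding laplace_kernel_def
  by (auto intro!: derivative_eq_intros simp: inner_commute)

text \<open>Integrating \<open>kernel_remainder\<close> bounds the remainder by
  \<open>C (norm h)^2\<close>, which is differentiability.\<close>

lemma has_derivative_integral_kernel:
  assumes p: "p \<in> orthant"
  shows "((\<lambda>p. \<integral>w. laplace_kernel w vs p \<partial>M) has_derivative (\<lambda>h. \<integral>w. laplace_kernel w (h # vs) p \<partial>M)) (at p)"
proof -
  obtain e where e: "e > 0" "p - e *\<^sub>R One \<in> orthant" using orthant_shift[OF p] .
  let ?I = "\<lambda>vs p. \<integral>w. laplace_kernel w vs p \<partial>M"
  define C where "C = (\<integral>w. \<bar>laplace_kernel w (One # One # vs) (p - e *\<^sub>R One)\<bar> \<partial>M)"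
  \<comment> \<open>All coordinates of \<open>p\<close> exceed \<open>e\<close>, so the same margin
    also keeps \<open>p + h\<close> in the orthant.\<close>
  have ball: "p + h \<in> orthant" if "norm h < e" for h
  proof -
    have "p \<bullet> b + h \<bullet> b > 0" if "b \<in> Basis" for b
    proof -
      have "\<bar>h \<bullet> b\<bar> < e" using Basis_le_norm[OF that, of h] \<open>norm h < e\<close> by linarith
      moreover have "p \<bullet> b > e" using e(2) that by (auto simp: orthant_def inner_diff_left)
      ultimately show ?thesis by linarith
    qed
    then show ?thesis by (simp add: orthant_def inner_add_left)
  qed
  have lin: "linear (\<lambda>h. ?I (h # vs) p)"
  proof
    fix h k :: 'e and c :: real
    have add: "laplace_kernel w ((h + k) # vs) p = laplace_kernel w (h # vs) p + laplace_kernel w (k # vs) p" for w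
      by (simp add: laplace_kernel_def inner_add_right algebra_simps)
    have scale: "laplace_kernel w ((c *\<^sub>R h) # vs) p = c * laplace_kernel w (h # vs) p" for w
      by (simp add: laplace_kernel_def)
    show "?I ((h + k) # vs) p = ?I (h # vs) p + ?I (k # vs) p"
      unfolding add by (intro Bochner_Integration.integral_add kernel_integrable p)
    show "?I ((c *\<^sub>R h) # vs) p = c *\<^sub>R ?I (h # vs) p"
      unfolding scale by simp
  qed
  have bound: "norm (?I vs (p + h) - ?I vs p - ?I (h # vs) p) / norm h \<le> C * norm h"
    if h: "norm h < e" "h \<noteq> 0" for h
  proof -
    have int: "integrable M (\<lambda>w. laplace_kernel w vs (p + h) - laplace_kernel w vs p - laplace_kernel w (h # vs) p)"
      using h by (intro Bochner_Integration.integrable_diff kernel_integrable p ball)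
    have "?I vs (p + h) - ?I vs p - ?I (h # vs) p
        = (\<integral>w. laplace_kernel w vs (p + h) - laplace_kernel w vs p - laplace_kernel w (h # vs) p \<partial>M)"
      using h by (simp add: Bochner_Integration.integral_diff kernel_integrable p ball
          Bochner_Integration.integrable_diff)
    also have "norm \<dots> \<le> (\<integral>w. norm (laplace_kernel w vs (p + h) - laplace_kernel w vs p - laplace_kernel w (h # vs) p) \<partial>M)"
      by (rule integral_norm_bound)
    also have "\<dots> \<le> (\<integral>w. (norm h)\<^sup>2 * \<bar>laplace_kernel w (One # One # vs) (p - e *\<^sub>R One)\<bar> \<partial>M)"
    proof (rule integral_mono[OF integrable_norm[OF int]])
      show "integrable M (\<lambda>w. (norm h)\<^sup>2 * \<bar>laplace_kernel w (One # One # vs) (p - e *\<^sub>R One)\<bar>)"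
        by (intro integrable_mult_right integrable_abs kernel_integrable e)
    qed (use kernel_remainder[of _ h e] h in auto)
    also have "\<dots> = (norm h)\<^sup>2 * C" by (simp add: C_def)
    finally show ?thesis using h by (simp add: divide_le_eq power2_eq_square mult_ac)
  qed
  have "((\<lambda>h. norm (?I vs (p + h) - ?I vs p - ?I (h # vs) p) / norm h) \<longlongrightarrow> 0) (at 0)"
  proof (rule Lim_null_comparison)
    show "\<forall>\<^sub>F h in at 0. norm (norm (?I vs (p + h) - ?I vs p - ?I (h # vs) p) / norm h) \<le> C * norm h"
      unfolding eventually_at using bound e(1) by (intro exI[of _ e]) auto
    show "((\<lambda>h. C * norm h) \<longlongrightarrow> 0) (at (0::'e))"
      by (rule tendsto_eq_intros | simp)+
  qed
  then show ?thesis
    using lin by (simp add: has_derivative_at linear_conv_bounded_linear)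
qed

text \<open>The mixture and each of its integrands share the coefficients of the term calculus, so
  iterated derivatives pass under the integral and inherit the sign pointwise in
  \<open>w\<close>.\<close>

lemma cm_along_mixture:
  fixes q :: "'a::real_normed_vector \<Rightarrow> 'e"
  assumes K: "open K" and g: "smooth_on K g"
    and q: "\<And>b. b \<in> Basis \<Longrightarrow> smooth_on K (\<lambda>x. q x \<bullet> b)" "\<And>x. x \<in> K \<Longrightarrow> q x \<in> orthant"
    and cm: "\<And>w. w \<in> space M \<Longrightarrow> cm_along U K (\<lambda>x. g x * exp (- (q x \<bullet> z w)))"
  shows "cm_along U K (\<lambda>x. g x * (\<integral>w. exp (- (q x \<bullet> z w)) \<partial>M))"
proof -
  obtain L :: "'e list" where L: "set L = Basis" "distinct L"
    using finite_distinct_list[OF finite_Basis] by blast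
  let ?a = "\<lambda>b x. q x \<bullet> b" and ?start = "[(g, [] :: 'e list)]"
  let ?I = "\<lambda>i p. \<integral>w. laplace_kernel w i p \<partial>M"
  have start: "\<forall>(P, i)\<in>set ?start. smooth_on K P" using g by simp
  have a: "\<And>l. l \<in> set L \<Longrightarrow> smooth_on K (?a l)" using L q(1) by simp
  have sysI: "diff_system K L ?a (\<lambda>i x. ?I i (q x))"
    by (rule diff_system_inner[where \<phi> = ?I])
      (use has_derivative_integral_kernel q L in auto)
  have sys: "diff_system K L ?a (\<lambda>i x. laplace_kernel w i (q x))" for w
    by (rule diff_system_inner[where \<phi> = "laplace_kernel w"])
      (use has_derivative_kernel q L in auto)
  have val: "term_val ?start (\<lambda>i x. ?I i (q x)) = (\<lambda>x. g x * (\<integral>w. exp (- (q x \<bullet> z w)) \<partial>M))"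
    by (simp add: term_val_def[abs_def] laplace_kernel_def)
  have valw: "term_val ?start (\<lambda>i x. laplace_kernel w i (q x)) = (\<lambda>x. g x * exp (- (q x \<bullet> z w)))" for w
    by (simp add: term_val_def[abs_def] laplace_kernel_def)
  have "smooth_on K (term_val ?start (\<lambda>i x. ?I i (q x)))"
    by (rule smooth_on_term_val[OF K a start sysI])
  moreover have "0 \<le> (-1) ^ length us * foldr dir_deriv us (term_val ?start (\<lambda>i x. ?I i (q x))) x"
    if us: "set us \<subseteq> U" and x: "x \<in> K" for us x
  proof -
    let ?ts = "foldr (term_deriv L ?a) us ?start"
    have "foldr dir_deriv us (term_val ?start (\<lambda>i x. ?I i (q x))) x = term_val ?ts (\<lambda>i x. ?I i (q x)) x"
      by (rule foldr_dir_deriv_term_val[OF K a start sysI x])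
    also have "\<dots> = (\<integral>w. term_val ?ts (\<lambda>i x. laplace_kernel w i (q x)) x \<partial>M)"
      by (rule integral_term_val(2)) (rule kernel_integrable[OF q(2)[OF x]])
    finally have "(-1) ^ length us * foldr dir_deriv us (term_val ?start (\<lambda>i x. ?I i (q x))) x
      = (\<integral>w. (-1) ^ length us * term_val ?ts (\<lambda>i x. laplace_kernel w i (q x)) x \<partial>M)"
      by simp
    also have "\<dots> \<ge> 0"
    proof (rule integral_nonneg_AE, rule AE_I2)
      fix w assume w: "w \<in> space M"
      have "term_val ?ts (\<lambda>i x. laplace_kernel w i (q x)) x
          = foldr dir_deriv us (term_val ?start (\<lambda>i x. laplace_kernel w i (q x))) x"
        by (rule foldr_dir_deriv_term_val[OF K a start sys x, symmetric])
      then show "0 \<le> (-1) ^ length us * term_val ?ts (\<lambda>i x. laplace_kernel w i (q x)) x"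
        using cm_alongD[OF cm[OF w] us x] unfolding valw by simp
    qed
    finally show ?thesis .
  qed
  ultimately show ?thesis unfolding val cm_along_def by blast
qed

end

section \<open>The Wishart integral\<close>

lemma nn_integral_gamma_powr:
  fixes c \<alpha> :: real
  assumes "\<alpha> > 0" "c > 0"
  shows "(\<integral>\<^sup>+k. ennreal (indicator {0..} k * k powr (\<alpha> - 1) / Gamma \<alpha>) * ennreal (exp (- (c * \<bar>k\<bar>))) \<partial>lborel)
    = ennreal (c powr (-\<alpha>))"
proof -
  let ?g = "\<lambda>k. ennreal (indicator {0..} k * k powr (\<alpha> - 1) / exp k)"
  have "(\<integral>\<^sup>+k. ennreal (indicator {0..} k * k powr (\<alpha> - 1) / Gamma \<alpha>) * ennreal (exp (- (c * \<bar>k\<bar>))) \<partial>lborel)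
      = (\<integral>\<^sup>+k. ennreal (c powr (1 - \<alpha>) / Gamma \<alpha>) * ?g (0 + c * k) \<partial>lborel)"
  proof (rule nn_integral_cong)
    fix k :: real
    have "indicator {0..} k * k powr (\<alpha> - 1) / Gamma \<alpha> * exp (- (c * \<bar>k\<bar>))
        = c powr (1 - \<alpha>) / Gamma \<alpha> * (indicator {0..} (0 + c * k) * (0 + c * k) powr (\<alpha> - 1) / exp (0 + c * k))"
    proof (cases "k \<ge> 0")
      case True
      have "c powr (1 - \<alpha>) * c powr (\<alpha> - 1) = 1"
        using assms(2) by (simp add: powr_add[symmetric])
      then show ?thesis using True assms by (simp add: powr_mult exp_minus divide_simps mult_ac)
    next
      case False
      then have "\<not> 0 \<le> c * k" using assms(2) by (simp add: zero_le_mult_iff)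
      with False show ?thesis by simp
    qed
    then show "ennreal (indicator {0..} k * k powr (\<alpha> - 1) / Gamma \<alpha>) * ennreal (exp (- (c * \<bar>k\<bar>)))
        = ennreal (c powr (1 - \<alpha>) / Gamma \<alpha>) * ?g (0 + c * k)"
      using assms Gamma_real_pos[OF assms(1)] by (simp add: ennreal_mult[symmetric])
  qed
  also have "\<dots> = ennreal (c powr (1 - \<alpha>) / Gamma \<alpha>) * (\<integral>\<^sup>+k. ?g (0 + c * k) \<partial>lborel)"
    by (rule nn_integral_cmult) measurable
  also have "(\<integral>\<^sup>+k. ?g (0 + c * k) \<partial>lborel) = ennreal (Gamma \<alpha> / c)"
  proof -
    have "ennreal c * (\<integral>\<^sup>+k. ?g (0 + c * k) \<partial>lborel) = ennreal (Gamma \<alpha>)"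
      using nn_integral_real_affine[of ?g c 0] assms Gamma_conv_nn_integral_real[OF assms(1)] by simp
    then have "ennreal (1 / c) * (ennreal c * (\<integral>\<^sup>+k. ?g (0 + c * k) \<partial>lborel)) = ennreal (1 / c) * ennreal (Gamma \<alpha>)"
      by simp
    moreover have "ennreal (1 / c) * ennreal c = 1" using assms by (simp add: ennreal_mult[symmetric])
    ultimately show ?thesis
      using assms Gamma_real_pos[OF assms(1)] by (simp add: mult.assoc[symmetric] ennreal_mult[symmetric])
  qed
  also have "ennreal (c powr (1 - \<alpha>) / Gamma \<alpha>) * ennreal (Gamma \<alpha> / c) = ennreal (c powr (-\<alpha>))"
    using assms Gamma_real_pos[OF assms(1)]
    by (simp add: ennreal_mult[symmetric] powr_diff powr_minus_divide less_imp_neq[symmetric])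
  finally show ?thesis .
qed

text \<open>The Gamma distribution of shape \<open>\<alpha>\<close>, degenerating to the point mass
  at 0 for \<open>\<alpha> = 0\<close>; this case occurs at \<open>\<beta> = 1/2\<close>. The
  absolute value makes the exponents nonnegative everywhere, not just almost everywhere.\<close>

lemma ex_gamma_measure:
  fixes \<alpha> :: real
  assumes "\<alpha> \<ge> 0"
  obtains N :: "real measure" where "sets N = sets borel" "sigma_finite_measure N"
    "\<And>c. c > 0 \<Longrightarrow> (\<integral>\<^sup>+k. ennreal (exp (- (c * \<bar>k\<bar>))) \<partial>N) = ennreal (c powr (-\<alpha>))"
proof (cases "\<alpha> = 0")
  case True
  show ?thesis
  proof (rule that[of "return borel 0"])
    show "sigma_finite_measure (return borel (0::real))"
      by (intro prob_space_imp_sigma_finite prob_space_return) simp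
    show "(\<integral>\<^sup>+k. ennreal (exp (- (c * \<bar>k\<bar>))) \<partial>return borel 0) = ennreal (c powr - \<alpha>)" if "c > 0" for c
      using that True by (subst nn_integral_return) auto
  qed simp
next
  case False
  then have pos: "\<alpha> > 0" using assms by simp
  let ?f = "\<lambda>k::real. ennreal (indicator {0..} k * k powr (\<alpha> - 1) / Gamma \<alpha>)"
  show ?thesis
  proof (rule that[of "density lborel ?f"])
    show "sigma_finite_measure (density lborel ?f)"
      by (subst sigma_finite_measure.sigma_finite_iff_density_finite[OF sigma_finite_lborel]) auto
    show "(\<integral>\<^sup>+k. ennreal (exp (- (c * \<bar>k\<bar>))) \<partial>density lborel ?f) = ennreal (c powr - \<alpha>)" if "c > 0" for c
      using nn_integral_gamma_powr[OF pos that] by (subst nn_integral_density) auto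
  qed simp
qed

lemma nn_integral_gaussian:
  fixes c m :: real
  assumes "c > 0"
  shows "(\<integral>\<^sup>+r. ennreal (exp (- (c * (r - m)\<^sup>2))) \<partial>lborel) = ennreal (sqrt (pi / c))"
proof -
  \<comment> \<open>The integrand is a multiple of the normal density with variance
    \<open>1 / (2 c)\<close>.\<close>
  define s where "s = sqrt (1 / (2 * c))"
  have s: "s > 0" "s\<^sup>2 = 1 / (2 * c)" using assms by (simp_all add: s_def)
  have "exp (- (c * (r - m)\<^sup>2)) = sqrt (pi / c) * normal_density m s r" for r
    using assms by (simp add: normal_density_def s(2) real_sqrt_divide mult_ac)
  then have "(\<integral>\<^sup>+r. ennreal (exp (- (c * (r - m)\<^sup>2))) \<partial>lborel)
      = (\<integral>\<^sup>+r. ennreal (sqrt (pi / c)) * ennreal (normal_density m s r) \<partial>lborel)"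
    using assms by (simp add: ennreal_mult)
  also have "\<dots> = ennreal (sqrt (pi / c)) * (\<integral>\<^sup>+r. ennreal (normal_density m s r) \<partial>lborel)"
    by (rule nn_integral_cmult) measurable
  also have "(\<integral>\<^sup>+r. ennreal (normal_density m s r) \<partial>lborel) = 1"
    using s by (subst nn_integral_eq_integral) auto
  finally show ?thesis by simp
qed

text \<open>The Bartlett coordinates of a \<open>2 \<times> 2\<close> Wishart matrix \<open>S\<close>: its entries are
  \<open>S\<^sub>1\<^sub>1 = \<bar>\<tau>\<bar>\<close>, \<open>S\<^sub>1\<^sub>2 = \<surd>\<bar>\<tau>\<bar> r\<close>, \<open>S\<^sub>2\<^sub>2 = r\<^sup>2 + \<bar>\<kappa>\<bar>\<close>, and the last component is
  \<open>S\<^sub>1\<^sub>1 + S\<^sub>2\<^sub>2 - 2 S\<^sub>1\<^sub>2\<close>. Hence \<open>(a, b, y) \<bullet> bartlett\<close> is the trace of \<open>S\<close> times the matrix with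
  rows \<open>(a + y, -y)\<close> and \<open>(-y, b + y)\<close>, whose determinant is \<open>a b + (a + b) y\<close>.\<close>

definition bartlett :: "real \<times> real \<times> real \<Rightarrow> real \<times> real \<times> real" where
  "bartlett = (\<lambda>(\<tau>, r, \<kappa>). (\<bar>\<tau>\<bar>, r\<^sup>2 + \<bar>\<kappa>\<bar>, (sqrt \<bar>\<tau>\<bar> - r)\<^sup>2 + \<bar>\<kappa>\<bar>))"

lemma bartlett_meas: "bartlett \<in> borel_measurable (borel \<Otimes>\<^sub>M (borel \<Otimes>\<^sub>M borel))"
  unfolding bartlett_def by measurable

text \<open>With \<open>c = b + y\<close> the determinant is \<open>c d\<close>, where
  \<open>d\<close> is the Schur complement \<open>a + y - y^2 / c\<close>. Integrating over
  \<open>\<kappa>\<close>, \<open>r\<close>, \<open>\<tau>\<close> in turn yields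
  \<open>c^(-(\<beta> - 1/2))\<close>, \<open>sqrt (pi / c)\<close> and
  \<open>d^(-\<beta>)\<close>.\<close>

lemma nn_integral_bartlett:
  fixes \<beta> a b y :: real
  assumes N: "sets N = sets borel" "sigma_finite_measure N"
    "\<And>c. c > 0 \<Longrightarrow> (\<integral>\<^sup>+k. ennreal (exp (- (c * \<bar>k\<bar>))) \<partial>N) = ennreal (c powr (-\<beta>))"
    and N': "sets N' = sets borel" "sigma_finite_measure N'"
    "\<And>c. c > 0 \<Longrightarrow> (\<integral>\<^sup>+k. ennreal (exp (- (c * \<bar>k\<bar>))) \<partial>N') = ennreal (c powr (- (\<beta> - 1/2)))"
    and pos: "a > 0" "b > 0" "y > 0"
  shows "(\<integral>\<^sup>+w. ennreal (exp (- ((a, b, y) \<bullet> bartlett w))) \<partial>(N \<Otimes>\<^sub>M (lborel \<Otimes>\<^sub>M N')))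
    = ennreal (sqrt pi * (a * b + (a + b) * y) powr (-\<beta>))"
proof -
  interpret N: sigma_finite_measure N by fact
  interpret N': sigma_finite_measure N' by fact
  interpret L: sigma_finite_measure "lborel \<Otimes>\<^sub>M N'" by (intro sigma_finite_pair_measure lborel.sigma_finite_measure_axioms N'.sigma_finite_measure_axioms)
  have [measurable_cong]: "sets N = sets borel" "sets N' = sets borel" by fact+
  note [measurable] = bartlett_meas
  let ?c = "b + y"
  let ?d = "a + b * y / ?c"
  have c: "?c > 0" and d: "?d > 0" using pos by (auto intro!: add_pos_pos divide_pos_pos)
  have "(\<integral>\<^sup>+w. ennreal (exp (- ((a, b, y) \<bullet> bartlett w))) \<partial>(N \<Otimes>\<^sub>M (lborel \<Otimes>\<^sub>M N')))
      = (\<integral>\<^sup>+\<tau>. \<integral>\<^sup>+w. ennreal (exp (- ((a, b, y) \<bullet> bartlett (\<tau>, w)))) \<partial>(lborel \<Otimes>\<^sub>M N') \<partial>N)"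
    by (rule L.nn_integral_fst[symmetric]) measurable
  also have "\<dots> = (\<integral>\<^sup>+\<tau>. \<integral>\<^sup>+r. \<integral>\<^sup>+\<kappa>. ennreal (exp (- ((a, b, y) \<bullet> bartlett (\<tau>, r, \<kappa>)))) \<partial>N' \<partial>lborel \<partial>N)"
    by (intro nn_integral_cong N'.nn_integral_fst[symmetric]) measurable
  also have "\<dots> = (\<integral>\<^sup>+\<tau>. \<integral>\<^sup>+r. ennreal (exp (- (?d * \<bar>\<tau>\<bar>)) * ?c powr (- (\<beta> - 1/2)))
      * ennreal (exp (- (?c * (r - y * sqrt \<bar>\<tau>\<bar> / ?c)\<^sup>2))) \<partial>lborel \<partial>N)"
  proof (intro nn_integral_cong)
    fix \<tau> r :: real
    let ?e = "exp (- (?d * \<bar>\<tau>\<bar>)) * exp (- (?c * (r - y * sqrt \<bar>\<tau>\<bar> / ?c)\<^sup>2))"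
    \<comment> \<open>Completing the square in \<open>r\<close>.\<close>
    have square: "a * \<bar>\<tau>\<bar> + b * r\<^sup>2 + y * (sqrt \<bar>\<tau>\<bar> - r)\<^sup>2
        = ?d * \<bar>\<tau>\<bar> + ?c * (r - y * sqrt \<bar>\<tau>\<bar> / ?c)\<^sup>2"
    proof -
      obtain s where s: "sqrt \<bar>\<tau>\<bar> = s" "\<bar>\<tau>\<bar> = s\<^sup>2"
        by (rule that[of "sqrt \<bar>\<tau>\<bar>"]) auto
      \<comment> \<open>Writing \<open>y = c k\<close>, hence \<open>b = c - c k\<close>, clears all
        denominators and leaves a polynomial identity.\<close>
      obtain k where k: "y = ?c * k" using c by (intro that[of "y / ?c"]) simp
      have "b * y / ?c = b * k" "y * s / ?c = k * s"
        using c by (subst k, simp)+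
      moreover have "b * r\<^sup>2 + y * (s - r)\<^sup>2 = b * k * s\<^sup>2 + ?c * (r - k * s)\<^sup>2"
      proof -
        have "(e - e * k) * r\<^sup>2 + e * k * (s - r)\<^sup>2 = (e - e * k) * k * s\<^sup>2 + e * (r - k * s)\<^sup>2"
          for e :: real by algebra
        from this[of ?c] show ?thesis by (simp only: k[symmetric] add_diff_cancel_right')
      qed
      ultimately show ?thesis
        unfolding s(1) unfolding s(2) by (simp add: distrib_right)
    qed
    have "(a, b, y) \<bullet> bartlett (\<tau>, r, \<kappa>)
        = (?d * \<bar>\<tau>\<bar> + ?c * (r - y * sqrt \<bar>\<tau>\<bar> / ?c)\<^sup>2) + ?c * \<bar>\<kappa>\<bar>" for \<kappa>
      unfolding square[symmetric] by (simp add: bartlett_def algebra_simps)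
    then have "exp (- ((a, b, y) \<bullet> bartlett (\<tau>, r, \<kappa>))) = ?e * exp (- (?c * \<bar>\<kappa>\<bar>))" for \<kappa>
      by (simp only: minus_add_distrib exp_add)
    then have "(\<integral>\<^sup>+\<kappa>. ennreal (exp (- ((a, b, y) \<bullet> bartlett (\<tau>, r, \<kappa>)))) \<partial>N')
        = (\<integral>\<^sup>+\<kappa>. ennreal ?e * ennreal (exp (- (?c * \<bar>\<kappa>\<bar>))) \<partial>N')"
      by (simp add: ennreal_mult)
    also have "\<dots> = ennreal ?e * ennreal (?c powr (- (\<beta> - 1/2)))"
      using N'(3)[OF c] by (subst nn_integral_cmult) auto
    finally show "(\<integral>\<^sup>+\<kappa>. ennreal (exp (- ((a, b, y) \<bullet> bartlett (\<tau>, r, \<kappa>)))) \<partial>N')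
        = ennreal (exp (- (?d * \<bar>\<tau>\<bar>)) * ?c powr (- (\<beta> - 1/2)))
          * ennreal (exp (- (?c * (r - y * sqrt \<bar>\<tau>\<bar> / ?c)\<^sup>2)))"
      by (simp add: ennreal_mult[symmetric] mult_ac)
  qed
  also have "\<dots> = (\<integral>\<^sup>+\<tau>. ennreal (?c powr (- (\<beta> - 1/2)) * sqrt (pi / ?c)) * ennreal (exp (- (?d * \<bar>\<tau>\<bar>))) \<partial>N)"
  proof (intro nn_integral_cong)
    \<comment> \<open>The Gaussian integral does not depend on its centre, so the dependence on
      \<open>sqrt \<bar>\<tau>\<bar>\<close> disappears.\<close>
    fix \<tau> :: real
    show "(\<integral>\<^sup>+r. ennreal (exp (- (?d * \<bar>\<tau>\<bar>)) * ?c powr (- (\<beta> - 1/2)))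
        * ennreal (exp (- (?c * (r - y * sqrt \<bar>\<tau>\<bar> / ?c)\<^sup>2))) \<partial>lborel)
      = ennreal (?c powr (- (\<beta> - 1/2)) * sqrt (pi / ?c)) * ennreal (exp (- (?d * \<bar>\<tau>\<bar>)))"
      using nn_integral_gaussian[OF c, of "y * sqrt \<bar>\<tau>\<bar> / ?c"] c
      by (subst nn_integral_cmult) (auto simp: ennreal_mult[symmetric] mult_ac)
  qed
  also have "\<dots> = ennreal (?c powr (- (\<beta> - 1/2)) * sqrt (pi / ?c)) * ennreal (?d powr (-\<beta>))"
    using N(3)[OF d] by (subst nn_integral_cmult) auto
  also have "\<dots> = ennreal (sqrt pi * (a * b + (a + b) * y) powr (-\<beta>))"
  proof -
    have "a * b + (a + b) * y = ?c * ?d" using c by (simp add: field_simps)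
    then have "(a * b + (a + b) * y) powr (-\<beta>) = ?c powr (-\<beta>) * ?d powr (-\<beta>)"
      using c d by (simp only: powr_mult)
    moreover have "?c powr (- (\<beta> - 1/2)) * sqrt (pi / ?c) = sqrt pi * ?c powr (-\<beta>)"
    proof -
      \<comment> \<open>The missing half power cancels against the Gaussian normalization.\<close>
      have "?c powr (- (\<beta> - 1/2)) = ?c powr (-\<beta>) * sqrt ?c"
        using c by (simp add: powr_half_sqrt[symmetric] powr_add[symmetric])
      then show ?thesis using c by (simp add: real_sqrt_divide)
    qed
    ultimately show ?thesis using c by (simp add: ennreal_mult[symmetric] mult_ac)
  qed
  finally show ?thesis .
qed

section \<open>The Wishart mixture evaluated at \<open>(A/B, C/D, y)\<close>\<close>

theorem proposition3p6:
  fixes K :: "'v::real_normed_vector set"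
    and A B C D :: "'v \<Rightarrow> real"
    and \<beta> :: real
  assumes "\<exists>S::'v set. finite S \<and> span S = UNIV"
    and "open_convex_cone K"
    and "\<beta> \<ge> 1/2"
    and "\<And>x. x \<in> K \<Longrightarrow> A x > 0"
    and "\<And>x. x \<in> K \<Longrightarrow> B x > 0"
    and "\<And>x. x \<in> K \<Longrightarrow> C x > 0"
    and "\<And>x. x \<in> K \<Longrightarrow> D x > 0"
    and "completely_monotone_on (K \<times> {0<..}) (\<lambda>(x, y). (A x + B x * y) powr (-\<beta>))"
    and "completely_monotone_on (K \<times> {0<..}) (\<lambda>(x, y). (C x + D x * y) powr (-\<beta>))"
  shows "completely_monotone_on (K \<times> {0<..})
           (\<lambda>(x, y). (A x * C x + (A x * D x + B x * C x) * y) powr (-\<beta>))"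
proof -
  interpret AB: affine_family K A B \<beta>
    using assms by unfold_locales auto
  interpret CD: affine_family K C D \<beta>
    using assms by unfold_locales auto
  let ?\<Omega> = "K \<times> {0::real<..}"
  let ?a = "\<lambda>p::'v \<times> real. A (fst p) / B (fst p)" and ?b = "\<lambda>p::'v \<times> real. C (fst p) / D (fst p)"
  let ?q = "\<lambda>p. (?a p, ?b p, snd p)"
  let ?g = "\<lambda>p::'v \<times> real. B (fst p) powr (-\<beta>) * D (fst p) powr (-\<beta>)"
  note open_dom = AB.open_domain
  \<comment> \<open>The bound \<open>\<beta> \<ge> 1/2\<close> makes the shape of the second Gamma
    measure nonnegative.\<close>
  have "\<beta> \<ge> 0" "\<beta> - 1/2 \<ge> 0" using assms(3) by auto
  then obtain N N' :: "real measure" where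
    N: "sets N = sets borel" "sigma_finite_measure N"
      "\<And>c. c > 0 \<Longrightarrow> (\<integral>\<^sup>+k. ennreal (exp (- (c * \<bar>k\<bar>))) \<partial>N) = ennreal (c powr (-\<beta>))"
    and N': "sets N' = sets borel" "sigma_finite_measure N'"
      "\<And>c. c > 0 \<Longrightarrow> (\<integral>\<^sup>+k. ennreal (exp (- (c * \<bar>k\<bar>))) \<partial>N') = ennreal (c powr (- (\<beta> - 1/2)))"
    using ex_gamma_measure[of \<beta>] ex_gamma_measure[of "\<beta> - 1/2"] by metis
  let ?M = "N \<Otimes>\<^sub>M (lborel \<Otimes>\<^sub>M N')"
  have [measurable_cong]: "sets N = sets borel" "sets N' = sets borel" by fact+
  have meas: "bartlett \<in> borel_measurable ?M"
    using bartlett_meas by measurable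
  have integral: "integrable ?M (\<lambda>w. exp (- ((a, b, y) \<bullet> bartlett w)))"
      "(\<integral>w. exp (- ((a, b, y) \<bullet> bartlett w)) \<partial>?M) = sqrt pi * (a * b + (a + b) * y) powr (-\<beta>)"
    if "a > 0" "b > 0" "y > 0" for a b y
  proof -
    note nn = nn_integral_bartlett[OF N N' that]
    have m: "(\<lambda>w. exp (- ((a, b, y) \<bullet> bartlett w))) \<in> borel_measurable ?M"
      using meas by measurable
    show "integrable ?M (\<lambda>w. exp (- ((a, b, y) \<bullet> bartlett w)))"
      by (rule integrableI_nonneg[OF m]) (auto simp: nn)
    show "(\<integral>w. exp (- ((a, b, y) \<bullet> bartlett w)) \<partial>?M) = sqrt pi * (a * b + (a + b) * y) powr (-\<beta>)"
      by (subst integral_eq_nn_integral[OF m]) (auto simp: nn)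
  qed
  have Basis: "(Basis :: (real \<times> real \<times> real) set) = {(1, 0, 0), (0, 1, 0), (0, 0, 1)}"
    by (auto simp: Basis_prod_def zero_prod_def)
  interpret laplace_measure ?M bartlett
  proof
    fix p :: "real \<times> real \<times> real"
    assume pos: "\<And>b. b \<in> Basis \<Longrightarrow> p \<bullet> b > 0"
    obtain a b y where p: "p = (a, b, y)" by (rule prod_cases3)
    show "integrable ?M (\<lambda>w. exp (- (p \<bullet> bartlett w)))"
      using pos[of "(1, 0, 0)"] pos[of "(0, 1, 0)"] pos[of "(0, 0, 1)"]
      by (simp add: p Basis integral(1))
  qed (use meas in \<open>auto simp: Basis bartlett_def\<close>)
  have cm: "cm_along ?\<Omega> ?\<Omega> (\<lambda>p. ?g p * (\<integral>w. exp (- (?q p \<bullet> bartlett w)) \<partial>?M))"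
  proof (rule cm_along_mixture[OF open_dom])
    show "smooth_on ?\<Omega> ?g"
      by (intro smooth_on_mult smooth_on_const AB.smooth_B_powr CD.smooth_B_powr open_dom)
    show "smooth_on ?\<Omega> (\<lambda>p. ?q p \<bullet> b)" if "b \<in> Basis" for b
      using that AB.smooth_ratio CD.smooth_ratio smooth_on_snd[OF open_dom] by (auto simp: Basis)
    show "?q p \<in> orthant" if "p \<in> ?\<Omega>" for p
      using that assms(4-7) by (auto simp: orthant_def Basis)
    fix w
    obtain t s u where w: "bartlett w = (t, s, u)" "t \<ge> 0" "s \<ge> 0" "u \<ge> 0"
      by (cases w) (auto simp: bartlett_def)
    \<comment> \<open>For fixed \<open>w\<close> the weight \<open>?g\<close> is split so that each
      of the two ratio exponentials receives its own power, of \<open>B\<close> or of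
      \<open>D\<close>.\<close>
    have "cm_along ?\<Omega> ?\<Omega> (\<lambda>p. (B (fst p) powr (-\<beta>) * exp (- (t * ?a p)))
        * ((D (fst p) powr (-\<beta>) * exp (- (s * ?b p))) * exp (- (u * snd p))))"
      by (intro cm_along_mult cm_along_exp_snd AB.cm_exp_ratio CD.cm_exp_ratio open_dom w) auto
    moreover have "exp (- (?q p \<bullet> bartlett w)) = exp (- (t * ?a p)) * exp (- (s * ?b p)) * exp (- (u * snd p))"
      for p
      by (simp only: w(1) inner_prod_def fst_conv snd_conv inner_real_def minus_add_distrib exp_add mult_ac)
    ultimately show "cm_along ?\<Omega> ?\<Omega> (\<lambda>p. ?g p * exp (- (?q p \<bullet> bartlett w)))"
      by (simp only: mult_ac)
  qed
  have eq: "1 / sqrt pi * (?g p * (\<integral>w. exp (- (?q p \<bullet> bartlett w)) \<partial>?M))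
      = (\<lambda>(x, y). (A x * C x + (A x * D x + B x * C x) * y) powr (-\<beta>)) p"
    if "p \<in> ?\<Omega>" for p
  proof -
    let ?E = "?a p * ?b p + (?a p + ?b p) * snd p"
    have pos: "A (fst p) > 0" "B (fst p) > 0" "C (fst p) > 0" "D (fst p) > 0" "snd p > 0"
      using that assms(4-7) by auto
    \<comment> \<open>Extracting \<open>B D\<close> turns the target into \<open>?E\<close>, the
      determinant computed by the Wishart integral; \<open>1 / sqrt pi\<close> removes its
      constant.\<close>
    have "A (fst p) * C (fst p) + (A (fst p) * D (fst p) + B (fst p) * C (fst p)) * snd p
        = (B (fst p) * D (fst p)) * ?E"
      using pos by (simp add: field_simps)
    moreover have "?E > 0" using pos by (intro add_pos_pos mult_pos_pos divide_pos_pos)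
    ultimately show ?thesis
      using pos integral(2)[of "?a p" "?b p" "snd p"]
      by (simp add: powr_mult case_prod_beta)
  qed
  show ?thesis
    unfolding completely_monotone_on_iff
    by (rule cm_along_cong[OF open_dom eq cm_along_scale[OF open_dom _ cm]]) auto
qed

end
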